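(* Let $f=g+h$ on $X$ satisfy the standing assumption (H) described in the context. Let $(x^n)_{n\in\mathbb N}$ be generated by the thresholding gradient algorithm $$x^0\in X,\quad \lambda\in\left]0,2L^{-1}\right[,\quad x^{n+1}=\operatorname{prox}_{\lambda g}\big(x^n-\lambda\nabla h(x^n)\big).$$ Then: (i) There exists a finite set $J\subset\mathcal N$ such that $x^n\in X_J$ for all $n\ge1$. (ii) $x^n$ converges strongly to some $\bar x\in\operatorname{argmin}f$.
   Context: $X$ is a real separable Hilbert space with inner product $\langle\cdot,\cdot\rangle$ and norm $\|\cdot\|$; $\mathcal N\subset\mathbb N$ and $(e_k)_{k\in\mathcal N}$ is an orthonormal basis of $X$; for $x\in X$, $x_k=\langle x,e_k\rangle$. $\Gamma_0(H)$ denotes the set of proper convex lower semicontinuous functions from a Hilbert space $H$ to $\mathbb R\cup\{+\infty\}$. For an interval $I\subset\mathbb R$, $\sigma_I(t)=\sup_{s\in I}st$ is its support function. Standing assumption (H): $f=g+h$, where - $h\in\Gamma_0(X)$ is bounded from below and differentiable, and $\nabla h$ is $L$-Lipschitz continuous on $X$, $L\in\left]0,+\infty\right[$; - $g(x)=\sum_{k\in\mathcal N}g_k(x_k)$ with $g_k=\psi_k+\sigma_{I_k}$, where each $I_k$ is a proper closed interval of $\mathbb R$ ($I_k\neq\mathbb R$), there exists $\omega>0$ such that $[-\omega,\omega]\subset I_k$ for all $k\in\mathcal N$, and each $\psi_k\in\Gamma_0(\mathbb R)$ is differentiable at $0$ with $\psi_k(0)=0$ and $\psi_k'(0)=0$.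 $\operatorname{prox}_{\lambda g}(x)$ is the unique minimizer of $y\mapsto g(y)+\frac1{2\lambda}\|y-x\|^2$. $\operatorname{supp}(x)=\{k\in\mathcal N:x_k\ne0\}$, and $X_J=\{x\in X:\operatorname{supp}(x)\subset J\}$ for $J\subset\mathcal N$. *)

theory Defs
  imports "HOL-Analysis.Analysis"
begin

definition orthonormal_basis :: "nat set \<Rightarrow> (nat \<Rightarrow> 'a::real_inner) \<Rightarrow> bool" where
  "orthonormal_basis N e \<longleftrightarrow>
     (\<forall>i\<in>N. \<forall>j\<in>N. e i \<bullet> e j = (if i = j then 1 else 0)) \<and> closure (span (e ` N)) = UNIV"

definition supp :: "nat set \<Rightarrow> (nat \<Rightarrow> 'a::real_inner) \<Rightarrow> 'a \<Rightarrow> nat set" where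
  "supp N e x = {k \<in> N. x \<bullet> e k \<noteq> 0}"

definition supp_subspace :: "nat set \<Rightarrow> (nat \<Rightarrow> 'a::real_inner) \<Rightarrow> nat set \<Rightarrow> 'a set" where
  "supp_subspace N e J = {x. supp N e x \<subseteq> J}"

definition proper_fun :: "('a \<Rightarrow> ereal) \<Rightarrow> bool" where
  "proper_fun f \<longleftrightarrow> (\<forall>x. f x \<noteq> -\<infinity>) \<and> (\<exists>x. f x \<noteq> \<infinity>)"

definition convex_fun :: "('a::real_vector \<Rightarrow> ereal) \<Rightarrow> bool" where
  "convex_fun f \<longleftrightarrow>
     (\<forall>x y t. 0 < t \<and> t < 1 \<longrightarrow>
        f ((1 - t) *\<^sub>R x + t *\<^sub>R y) \<le> ereal (1 - t) * f x + ereal t * f y)"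

definition lsc_fun :: "('a::topological_space \<Rightarrow> ereal) \<Rightarrow> bool" where
  "lsc_fun f \<longleftrightarrow> (\<forall>x. f x \<le> Liminf (at x) f)"

definition Gamma0 :: "('a::real_normed_vector \<Rightarrow> ereal) set" where
  "Gamma0 = {f. proper_fun f \<and> convex_fun f \<and> lsc_fun f}"

definition support_fun :: "real set \<Rightarrow> real \<Rightarrow> ereal" where
  "support_fun I t = (SUP s\<in>I. ereal (s * t))"

text \<open>Since \<^term>\<open>real_of_ereal \<infinity> = 0\<close>, finiteness near the point has to be required
  separately: otherwise the indicator function of \<open>{0}\<close> would count as differentiable at 0.\<close>

definition has_finite_derivative :: "(real \<Rightarrow> ereal) \<Rightarrow> real \<Rightarrow> real \<Rightarrow> bool" where
  "has_finite_derivative \<phi> D t \<longleftrightarrow>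
     (\<forall>\<^sub>F s in nhds t. \<bar>\<phi> s\<bar> \<noteq> \<infinity>) \<and>
     ((\<lambda>s. real_of_ereal (\<phi> s)) has_real_derivative D) (at t)"

definition argmin :: "('a \<Rightarrow> ereal) \<Rightarrow> 'a set" where
  "argmin f = {x. is_arg_min f (\<lambda>_. True) x}"

text \<open>The definite description denotes the minimizer only when it exists and is unique, which
  is the case for \<open>g \<in> Gamma0\<close> on a Hilbert space and \<open>\<gamma> > 0\<close>.\<close>

definition prox :: "real \<Rightarrow> ('a::real_normed_vector \<Rightarrow> ereal) \<Rightarrow> 'a \<Rightarrow> 'a" where
  "prox \<gamma> g x = (THE y. y \<in> argmin (\<lambda>y. g y + ereal (1 / (2 * \<gamma>) * (norm (y - x))\<^sup>2)))"

end

theory Submission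
  imports Defs
begin

text \<open>The optimality condition for minimizing \<open>g + h\<close> says that \<open>- \<nabla>h(z)\<close> is a subgradient of \<open>g\<close> at
\<open>z\<close>, which for every step size \<open>\<gamma> > 0\<close> is the fixed point equation \<open>z = T z\<close> of the forward-backward
map \<open>T u = prox (u - \<gamma> \<nabla>h(u))\<close>. Write \<open>r(u) = u - \<gamma> \<nabla>h(u) - T u\<close> for the residual of the proximal
step, so that \<open>r(u) / \<gamma>\<close> is a subgradient of \<open>g\<close> at \<open>T u\<close>. Firm nonexpansiveness of the proximal map
and cocoercivity of \<open>\<nabla>h\<close> (the theorem of Baillon and Haddad) combine to

  \<open>\<parallel>T u - T v\<parallel>\<^sup>2 + \<parallel>r(u) - r(v)\<parallel>\<^sup>2 + \<gamma> (2/L - \<gamma>) \<parallel>\<nabla>h(u) - \<nabla>h(v)\<parallel>\<^sup>2 \<le> \<parallel>u - v\<parallel>\<^sup>2\<close>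

(\<open>step_estimate\<close>). Everything rests on this estimate and on the existence of a fixed point \<open>z\<close>, that
is, of a minimizer (\<open>ex_argmin_add\<close>), which exists because the bound \<open>g(u) \<ge> \<omega> \<parallel>u\<parallel>\<close> and the lower
boundedness of \<open>h\<close> make the convex lower semicontinuous function \<open>g + h\<close> coercive.

\<^emph>\<open>Finite support.\<close> The support functions in the penalty grow at least like \<open>\<omega> \<bar>t\<bar>\<close> away from the origin,
so a subgradient of \<open>g\<close> at \<open>p\<close> has \<open>k\<close>-th coordinate of modulus at least \<open>\<omega>\<close> whenever \<open>p\<^sub>k \<noteq> 0\<close>
(\<open>subgradient_coordinate_ge\<close>). Hence an iterate \<open>x\<^bsup>n+1\<^esup>\<close> can be nonzero in coordinate \<open>k\<close> only if \<open>r(x\<^bsup>n\<^esup>)\<close> has modulus at least \<open>\<gamma>\<omega>\<close> there,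
and then \<open>r(z)\<close> or \<open>r(x\<^bsup>n\<^esup>) - r(z)\<close> has modulus at least \<open>\<gamma>\<omega>/2\<close> there. Summing the
estimate over the iterations shows that \<open>\<parallel>r(x\<^bsup>n\<^esup>) - r(z)\<parallel>\<^sup>2\<close> is summable; by Bessel's inequality only
finitely many coordinates can be that large for some \<open>n\<close> (\<open>finite_large_coordinates\<close>).

\<^emph>\<open>Strong convergence.\<close> The iterates are bounded and, from the first one on, lie in a
finite-dimensional subspace, so a subsequence converges in norm. The same summation gives
\<open>x\<^bsup>n+1\<^esup> - x\<^bsup>n\<^esup> \<rightarrow> 0\<close>, hence the cluster point is a fixed point of \<open>T\<close>. The distance to a fixed point
never increases, so the whole sequence converges to it.\<close>

section \<open>Orthonormal bases\<close>

text \<open>This Pythagorean identity contains both Bessel's inequality (take \<open>c\<^sub>k = \<langle>u, e\<^sub>k\<rangle>\<close>) and the fact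
that these coefficients give the best approximation of \<open>u\<close>.\<close>

lemma norm_diff_orthonormal_sum:
  fixes e :: "nat \<Rightarrow> 'a::real_inner"
  assumes on: "\<forall>i\<in>N. \<forall>j\<in>N. e i \<bullet> e j = (if i = j then 1 else 0)"
    and F: "finite F" "F \<subseteq> N"
  shows "(norm (u - (\<Sum>k\<in>F. c k *\<^sub>R e k)))\<^sup>2 =
         (norm u)\<^sup>2 - (\<Sum>k\<in>F. (u \<bullet> e k)\<^sup>2) + (\<Sum>k\<in>F. (u \<bullet> e k - c k)\<^sup>2)"
proof -
  define s where "s = (\<Sum>k\<in>F. c k *\<^sub>R e k)"
  have se: "s \<bullet> e k = c k" if "k \<in> F" for k
  proof -
    have "s \<bullet> e k = (\<Sum>j\<in>F. c j * (if j = k then 1 else 0))"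
      unfolding s_def inner_sum_left
    proof (rule sum.cong[OF refl])
      fix j assume "j \<in> F"
      then have "e j \<bullet> e k = (if j = k then 1 else 0)"
        using on F(2) that by blast
      then show "(c j *\<^sub>R e j) \<bullet> e k = c j * (if j = k then 1 else 0)"
        by simp
    qed
    also have "\<dots> = c k"
      using F that by (simp add: if_distrib cong: if_cong)
    finally show ?thesis .
  qed
  have ss: "s \<bullet> s = (\<Sum>k\<in>F. (c k)\<^sup>2)"
  proof -
    have "s \<bullet> s = (\<Sum>k\<in>F. c k * (s \<bullet> e k))"
      by (subst (2) s_def) (simp add: inner_sum_right)
    then show ?thesis
      by (simp add: se power2_eq_square)
  qed
  have us: "u \<bullet> s = (\<Sum>k\<in>F. c k * (u \<bullet> e k))"
    by (simp add: s_def inner_sum_right)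
  have "(norm (u - s))\<^sup>2 = (norm u)\<^sup>2 - 2 * (u \<bullet> s) + s \<bullet> s"
    by (simp add: power2_norm_eq_inner inner_diff_left inner_diff_right inner_commute)
  also have "\<dots> = (norm u)\<^sup>2 - (\<Sum>k\<in>F. (u \<bullet> e k)\<^sup>2) + (\<Sum>k\<in>F. (u \<bullet> e k - c k)\<^sup>2)"
    unfolding us ss
    by (simp add: power2_diff sum.distrib sum_subtractf sum_distrib_left algebra_simps)
  finally show ?thesis
    by (simp add: s_def)
qed

lemma bessel_inequality:
  fixes e :: "nat \<Rightarrow> 'a::real_inner"
  assumes "\<forall>i\<in>N. \<forall>j\<in>N. e i \<bullet> e j = (if i = j then 1 else 0)" "finite F" "F \<subseteq> N"
  shows "(\<Sum>k\<in>F. (u \<bullet> e k)\<^sup>2) \<le> (norm u)\<^sup>2"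
proof -
  have "0 \<le> (norm (u - (\<Sum>k\<in>F. (u \<bullet> e k) *\<^sub>R e k)))\<^sup>2"
    by simp
  then show ?thesis
    by (simp add: norm_diff_orthonormal_sum[OF assms])
qed

text \<open>Some finite linear combination of basis vectors is close to \<open>u\<close> by density; replacing its
coefficients by those of \<open>u\<close> only improves the approximation.\<close>

lemma orthonormal_basis_partial_sum_close:
  fixes e :: "nat \<Rightarrow> 'a::real_inner"
  assumes basis: "orthonormal_basis N e" and eps: "\<epsilon> > 0"
  obtains F where "finite F" "F \<subseteq> N" "norm (u - (\<Sum>k\<in>F. (u \<bullet> e k) *\<^sub>R e k)) < \<epsilon>"
proof -
  have on: "\<forall>i\<in>N. \<forall>j\<in>N. e i \<bullet> e j = (if i = j then 1 else 0)"
    and cl: "u \<in> closure (span (e ` N))"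
    using basis by (auto simp: orthonormal_basis_def)
  obtain v where v: "v \<in> span (e ` N)" "dist v u < \<epsilon>"
    using cl eps closure_approachable by blast
  obtain S r where S: "finite S" "S \<subseteq> e ` N" "v = (\<Sum>a\<in>S. r a *\<^sub>R a)"
    using v(1) by (auto simp: span_explicit)
  obtain F where F: "F \<subseteq> N" "finite F" "S = e ` F"
    using finite_subset_image[OF S(1,2)] by blast
  have inj: "inj_on e F"
  proof (rule inj_onI)
    fix i j assume "i \<in> F" "j \<in> F" "e i = e j"
    then show "i = j"
      using on F(1) by (metis subsetD zero_neq_one)
  qed
  have veq: "v = (\<Sum>k\<in>F. r (e k) *\<^sub>R e k)"
    using S(3) F(3) inj by (simp add: sum.reindex)
  have "(norm (u - (\<Sum>k\<in>F. (u \<bullet> e k) *\<^sub>R e k)))\<^sup>2 \<le> (norm (u - v))\<^sup>2"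
    unfolding veq norm_diff_orthonormal_sum[OF on F(2,1)] by (simp add: sum_nonneg)
  then have "norm (u - (\<Sum>k\<in>F. (u \<bullet> e k) *\<^sub>R e k)) \<le> norm (u - v)"
    by (rule power2_le_imp_le) simp
  also have "\<dots> < \<epsilon>"
    using v(2) by (simp add: dist_norm norm_minus_commute)
  finally show ?thesis
    using that F by blast
qed

text \<open>If \<open>u\<close> differed from its expansion over \<open>J\<close>, a partial sum over some finite \<open>F\<close> would come strictly
closer to \<open>u\<close>. But only the indices in \<open>F \<inter> J\<close> contribute to it, and adding orthogonal components
never increases the distance.\<close>

lemma supp_subspace_expansion:
  fixes e :: "nat \<Rightarrow> 'a::real_inner"
  assumes basis: "orthonormal_basis N e" and J: "finite J" "J \<subseteq> N"
    and u: "u \<in> supp_subspace N e J"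
  shows "u = (\<Sum>k\<in>J. (u \<bullet> e k) *\<^sub>R e k)"
proof (rule ccontr)
  let ?s = "\<lambda>F. \<Sum>k\<in>F. (u \<bullet> e k) *\<^sub>R e k"
  assume "u \<noteq> ?s J"
  then have "norm (u - ?s J) > 0"
    by simp
  then obtain F where F: "finite F" "F \<subseteq> N" "norm (u - ?s F) < norm (u - ?s J)"
    using orthonormal_basis_partial_sum_close[OF basis] by blast
  have zero: "u \<bullet> e k = 0" if "k \<in> N - J" for k
    using u that by (auto simp: supp_subspace_def supp_def)
  have "?s F = ?s (F \<inter> J)"
    using F zero by (intro sum.mono_neutral_right) auto
  have on: "\<forall>i\<in>N. \<forall>j\<in>N. e i \<bullet> e j = (if i = j then 1 else 0)"
    using basis by (auto simp: orthonormal_basis_def)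
  have "(\<Sum>k\<in>F. (u \<bullet> e k)\<^sup>2) = (\<Sum>k\<in>F \<inter> J. (u \<bullet> e k)\<^sup>2)"
    using F zero by (intro sum.mono_neutral_right) auto
  also have "\<dots> \<le> (\<Sum>k\<in>J. (u \<bullet> e k)\<^sup>2)"
    using J by (intro sum_mono2) auto
  finally have "(norm (u - ?s J))\<^sup>2 \<le> (norm (u - ?s F))\<^sup>2"
    using norm_diff_orthonormal_sum[OF on F(1,2), of u "\<lambda>k. u \<bullet> e k"]
      norm_diff_orthonormal_sum[OF on J, of u "\<lambda>k. u \<bullet> e k"] by simp
  then have "norm (u - ?s J) \<le> norm (u - ?s F)"
    by (rule power2_le_imp_le) simp
  with F(3) show False
    by simp
qed

text \<open>Bolzano--Weierstrass is applied to one coordinate after the other; the finitely many convergent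
coordinates determine the limit vector.\<close>

lemma bounded_supp_subspace_convergent_subseq:
  fixes e :: "nat \<Rightarrow> 'a::real_inner" and x :: "nat \<Rightarrow> 'a"
  assumes basis: "orthonormal_basis N e" and J: "finite J" "J \<subseteq> N"
    and x: "\<And>n. x n \<in> supp_subspace N e J" and bd: "bounded (range x)"
  obtains l s where "strict_mono (s :: nat \<Rightarrow> nat)" "(x \<circ> s) \<longlonglongrightarrow> l"
proof -
  have "\<exists>s. strict_mono (s :: nat \<Rightarrow> nat) \<and> (\<forall>k\<in>J. convergent (\<lambda>n. x (s n) \<bullet> e k))"
    using J(1)
  proof induction
    case empty
    show ?case
      by (intro exI[of _ "\<lambda>n. n"]) (simp add: strict_mono_def)
  next
    case (insert j K)
    obtain s where s: "strict_mono (s :: nat \<Rightarrow> nat)" "\<forall>k\<in>K. convergent (\<lambda>n. x (s n) \<bullet> e k)"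
      using insert.IH by blast
    have "bounded ((\<lambda>v. v \<bullet> e j) ` range x)"
      using bd by (rule bounded_linear_image) (rule bounded_linear_inner_left)
    then have "bounded (range (\<lambda>n. x (s n) \<bullet> e j))"
      by (rule bounded_subset) auto
    then obtain l r where r: "strict_mono r" "((\<lambda>n. x (s n) \<bullet> e j) \<circ> r) \<longlonglongrightarrow> l"
      using bounded_imp_convergent_subsequence by blast
    have "convergent (\<lambda>n. x ((s \<circ> r) n) \<bullet> e k)" if "k \<in> insert j K" for k
    proof (cases "k = j")
      case True
      then show ?thesis
        using r(2) by (auto simp: convergent_def o_def)
    next
      case False
      then show ?thesis
        using convergent_subseq_convergent[OF _ r(1), of "\<lambda>n. x (s n) \<bullet> e k"] s(2) that
        by (auto simp: o_def)
    qed
    then show ?case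
      using strict_mono_o[OF s(1) r(1)] by blast
  qed
  then obtain s where s: "strict_mono (s :: nat \<Rightarrow> nat)"
      "\<forall>k\<in>J. convergent (\<lambda>n. x (s n) \<bullet> e k)"
    by blast
  then have "\<forall>k\<in>J. \<exists>c. (\<lambda>n. x (s n) \<bullet> e k) \<longlonglongrightarrow> c"
    by (simp add: convergent_def)
  then obtain c where c: "\<forall>k\<in>J. (\<lambda>n. x (s n) \<bullet> e k) \<longlonglongrightarrow> c k"
    by metis
  have "(\<lambda>n. \<Sum>k\<in>J. (x (s n) \<bullet> e k) *\<^sub>R e k) \<longlonglongrightarrow> (\<Sum>k\<in>J. c k *\<^sub>R e k)"
    using c by (intro tendsto_sum tendsto_scaleR) auto
  then have "(x \<circ> s) \<longlonglongrightarrow> (\<Sum>k\<in>J. c k *\<^sub>R e k)"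
    using supp_subspace_expansion[OF basis J x] by (simp add: o_def)
  with s(1) show ?thesis
    using that by blast
qed

section \<open>Minimizers of coercive convex functions\<close>

text \<open>This replaces weak compactness. Pick almost norm-minimal points \<open>p\<^sub>n \<in> C\<^sub>n\<close>. The minimal squared norms
increase to a finite limit because the sets are bounded, and the midpoint of \<open>p\<^sub>n\<close> and \<open>p\<^sub>m\<close> stays in
the larger set, so the parallelogram law makes \<open>p\<close> a Cauchy sequence. Its limit lies in every
\<open>C\<^sub>n\<close>.\<close>

lemma decreasing_convex_sets_Inter_nonempty:
  fixes C :: "nat \<Rightarrow> 'a::{real_inner, banach} set"
  assumes ne: "\<And>n. C n \<noteq> {}" and cl: "\<And>n. closed (C n)" and cv: "\<And>n. convex (C n)"
    and dec: "decseq C" and bd: "bounded (C 0)"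
  shows "(\<Inter>n. C n) \<noteq> {}"
proof -
  define d where "d n = (INF u\<in>C n. (norm u)\<^sup>2)" for n
  have sub: "C m \<subseteq> C n" if "n \<le> m" for n m
    using dec that by (simp add: decseq_def)
  have bdd: "bdd_below ((\<lambda>u. (norm u)\<^sup>2) ` C n)" for n
    by (rule bdd_belowI[of _ 0]) auto
  have d_le: "d n \<le> (norm u)\<^sup>2" if "u \<in> C n" for n u
    unfolding d_def using bdd that by (rule cINF_lower)
  define r where "r n = inverse (real (Suc n))" for n
  have "\<exists>u. u \<in> C n \<and> (norm u)\<^sup>2 < d n + r n" for n
  proof -
    have "d n < d n + r n"
      by (simp add: r_def)
    then show ?thesis
      unfolding d_def using cINF_less_iff[OF ne bdd] by blast
  qed
  then obtain p where p: "\<And>n. p n \<in> C n" "\<And>n. (norm (p n))\<^sup>2 < d n + r n"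
    by metis
  have inc: "incseq d"
    unfolding incseq_def d_def using sub by (intro allI impI cINF_superset_mono ne bdd) auto
  obtain B where B: "\<And>u. u \<in> C 0 \<Longrightarrow> norm u \<le> B"
    using bd by (auto simp: bounded_iff)
  have d_bound: "d n \<le> B\<^sup>2" for n
  proof -
    have "norm (p n) \<le> B"
      using p(1) sub B by blast
    then have "(norm (p n))\<^sup>2 \<le> B\<^sup>2"
      by (simp add: power_mono)
    with d_le[OF p(1)] show ?thesis
      by (rule order_trans)
  qed
  obtain D where D: "d \<longlonglongrightarrow> D" "\<And>n. d n \<le> D"
    using incseq_convergent[OF inc, of "B\<^sup>2"] d_bound by blast
  have close: "(norm (p n - p m))\<^sup>2 \<le> 2 * (D - d n) + 4 * r n" if nm: "n \<le> m" for n m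
  proof -
    define w where "w = (1/2) *\<^sub>R p n + (1/2) *\<^sub>R p m"
    have "w \<in> C n"
      unfolding w_def using cv p(1) sub[OF nm] by (intro convexD) auto
    then have "d n \<le> (norm w)\<^sup>2"
      by (rule d_le)
    moreover have "(norm (p n - p m))\<^sup>2 =
        2 * (norm (p n))\<^sup>2 + 2 * (norm (p m))\<^sup>2 - 4 * (norm w)\<^sup>2"
      unfolding w_def power2_norm_eq_inner
      by (simp add: inner_diff_left inner_diff_right inner_add_left inner_add_right
          inner_commute[of "p m" "p n"]) (simp add: field_simps)
    moreover have "r m \<le> r n"
      unfolding r_def using nm by (intro le_imp_inverse_le) auto
    ultimately show ?thesis
      using p(2)[of n] p(2)[of m] D(2)[of m] by simp
  qed
  have "(\<lambda>n. 2 * (D - d n) + 4 * r n) \<longlonglongrightarrow> 2 * (D - D) + 4 * 0"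
    unfolding r_def by (intro tendsto_intros D LIMSEQ_inverse_real_of_nat)
  then have lim0: "(\<lambda>n. 2 * (D - d n) + 4 * r n) \<longlonglongrightarrow> 0"
    by simp
  have "Cauchy p"
  proof (rule metric_CauchyI)
    fix \<epsilon> :: real assume eps: "\<epsilon> > 0"
    have "eventually (\<lambda>n. 2 * (D - d n) + 4 * r n < (\<epsilon>/2)\<^sup>2) sequentially"
      by (rule order_tendstoD(2)[OF lim0]) (use eps in simp)
    then obtain M where M: "2 * (D - d M) + 4 * r M < (\<epsilon>/2)\<^sup>2"
      unfolding eventually_sequentially by blast
    have half: "norm (p M - p m) < \<epsilon> / 2" if "m \<ge> M" for m
    proof (rule power2_less_imp_less)
      show "(norm (p M - p m))\<^sup>2 < (\<epsilon> / 2)\<^sup>2"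
        using close[OF that] M by (rule order_le_less_trans)
    qed (use eps in simp)
    have "dist (p m) (p n) < \<epsilon>" if "m \<ge> M" "n \<ge> M" for m n
      using half[OF that(1)] half[OF that(2)] unfolding dist_norm[symmetric]
      by (rule dist_triangle_half_r)
    then show "\<exists>M. \<forall>m\<ge>M. \<forall>n\<ge>M. dist (p m) (p n) < \<epsilon>"
      by blast
  qed
  then obtain l where l: "p \<longlonglongrightarrow> l"
    by (auto simp: Cauchy_convergent_iff convergent_def)
  have "l \<in> C n" for n
  proof (rule closed_sequentially[OF cl])
    show "p (k + n) \<in> C n" for k
      using p(1) sub[of n "k + n"] by auto
    show "(\<lambda>k. p (k + n)) \<longlonglongrightarrow> l"
      using l by (rule LIMSEQ_ignore_initial_segment)
  qed
  then show ?thesis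
    by blast
qed

lemma lsc_fun_liminf:
  fixes f :: "'a::topological_space \<Rightarrow> ereal"
  assumes "lsc_fun f" "X \<longlonglongrightarrow> l"
  shows "f l \<le> liminf (\<lambda>n. f (X n))"
  unfolding le_Liminf_iff
proof (intro allI impI)
  fix y assume y: "y < f l"
  have "eventually (\<lambda>u. y < f u) (at l)"
    using assms(1) y by (auto simp: lsc_fun_def le_Liminf_iff)
  then have "eventually (\<lambda>u. y < f u) (nhds l)"
    unfolding eventually_at_filter by (rule eventually_mono) (use y in auto)
  then show "eventually (\<lambda>n. y < f (X n)) sequentially"
    using assms(2) by (rule eventually_compose_filterlim)
qed

lemma convex_fun_combination_le:
  assumes "convex_fun g" "0 < t" "t < 1" "g u \<le> ereal a" "g v \<le> ereal b"
  shows "g ((1 - t) *\<^sub>R u + t *\<^sub>R v) \<le> ereal ((1 - t) * a + t * b)"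
proof -
  have "g ((1 - t) *\<^sub>R u + t *\<^sub>R v) \<le> ereal (1 - t) * g u + ereal t * g v"
    using assms(1-3) by (simp add: convex_fun_def)
  also have "\<dots> \<le> ereal (1 - t) * ereal a + ereal t * ereal b"
    using assms(2-5) by (intro add_mono ereal_mult_left_mono) auto
  finally show ?thesis
    by simp
qed

lemma argmin_iff: "p \<in> argmin F \<longleftrightarrow> (\<forall>u. F p \<le> F u)"
  by (auto simp: argmin_def is_arg_min_def not_less)

text \<open>Lower semicontinuity is required along sequences, which is the form that passes to the infinite
sum of the coordinate penalties. The linear lower bound provides the boundedness of sublevel sets for
\<open>g + \<phi>\<close> whenever \<open>\<phi>\<close> is bounded below.\<close>

locale coercive_convex =
  fixes g :: "'a::{real_inner, banach} \<Rightarrow> ereal" and \<omega> :: real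
  assumes convex: "convex_fun g"
    and le_liminf: "\<And>X l. X \<longlonglongrightarrow> l \<Longrightarrow> g l \<le> liminf (\<lambda>n. g (X n))"
    and pos: "0 < \<omega>"
    and coercive: "\<And>u. ereal (\<omega> * norm u) \<le> g u"
    and zero: "g 0 = 0"
begin

lemma nonneg: "0 \<le> g u"
proof -
  have "0 \<le> ereal (\<omega> * norm u)"
    using pos by simp
  then show ?thesis
    using coercive by (rule order_trans)
qed

text \<open>The sublevel sets of \<open>g + \<phi>\<close> for levels decreasing to the infimum are closed, convex, nonempty, and
bounded by coercivity, so they have a common point. The two uses are \<open>\<phi> = h\<close>, which yields
the solution of the problem, and a quadratic \<open>\<phi>\<close>, which yields the proximal point.\<close>

lemma ex_argmin_add:
  assumes cv: "convex_on UNIV \<phi>" and ct: "continuous_on UNIV \<phi>" and bd: "bdd_below (range \<phi>)"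
  shows "\<exists>p. p \<in> argmin (\<lambda>u. g u + ereal (\<phi> u))"
proof -
  obtain b where b: "\<And>u. b \<le> \<phi> u"
    using bd by (auto simp: bdd_below_def)
  define m where "m = (INF u. g u + ereal (\<phi> u))"
  have "ereal b \<le> g u + ereal (\<phi> u)" for u
    using add_mono[OF nonneg[of u], of "ereal b" "ereal (\<phi> u)"] b by simp
  then have "ereal b \<le> m"
    unfolding m_def by (intro INF_greatest)
  moreover have "m \<le> ereal (\<phi> 0)"
    unfolding m_def using INF_lower[of 0 UNIV "\<lambda>u. g u + ereal (\<phi> u)"] zero by simp
  ultimately obtain c where c: "m = ereal c"
    by (cases m) auto
  define C where "C n = {u. g u \<le> ereal (c + 1 / Suc n - \<phi> u)}" for n
  have C_iff: "u \<in> C n \<longleftrightarrow> g u + ereal (\<phi> u) \<le> ereal (c + 1 / Suc n)" for u n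
    by (cases "g u") (auto simp: C_def)
  have "(\<Inter>n. C n) \<noteq> {}"
  proof (rule decreasing_convex_sets_Inter_nonempty)
    fix n
    have "m < ereal (c + 1 / Suc n)"
      by (simp add: c)
    then obtain u where "g u + ereal (\<phi> u) < ereal (c + 1 / Suc n)"
      unfolding m_def by (auto simp: INF_less_iff)
    then show "C n \<noteq> {}"
      using C_iff less_imp_le by blast
    show "closed (C n)"
      unfolding closed_sequential_limits
    proof (intro allI impI, elim conjE)
      fix X l assume X: "\<forall>j. X j \<in> C n" and l: "X \<longlonglongrightarrow> l"
      have "isCont \<phi> l"
        using ct by (simp add: continuous_on_eq_continuous_at)
      then have "(\<lambda>j. \<phi> (X j)) \<longlonglongrightarrow> \<phi> l"
        using l by (rule isCont_tendsto_compose)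
      then have lim: "(\<lambda>j. ereal (c + 1 / Suc n - \<phi> (X j))) \<longlonglongrightarrow> ereal (c + 1 / Suc n - \<phi> l)"
        by (intro tendsto_intros)
      have "g l \<le> liminf (\<lambda>j. g (X j))"
        using l by (rule le_liminf)
      also have "\<dots> \<le> liminf (\<lambda>j. ereal (c + 1 / Suc n - \<phi> (X j)))"
        using X by (intro Liminf_mono) (auto simp: C_def)
      also have "\<dots> = ereal (c + 1 / Suc n - \<phi> l)"
        using lim by (intro lim_imp_Liminf) auto
      finally show "l \<in> C n"
        by (simp add: C_def)
    qed
    show "convex (C n)"
      unfolding convex_alt
    proof (intro ballI allI impI, elim conjE)
      fix u v and t :: real
      assume uv: "u \<in> C n" "v \<in> C n" and t: "0 \<le> t" "t \<le> 1"
      show "(1 - t) *\<^sub>R u + t *\<^sub>R v \<in> C n"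
      proof (cases "t = 0 \<or> t = 1")
        case True
        then show ?thesis
          using uv by auto
      next
        case False
        define a where "a = c + 1 / Suc n"
        have "g ((1 - t) *\<^sub>R u + t *\<^sub>R v) \<le> ereal ((1 - t) * (a - \<phi> u) + t * (a - \<phi> v))"
          using uv t False unfolding a_def
          by (intro convex_fun_combination_le[OF convex]) (auto simp: C_def)
        also have "\<dots> = ereal (a - ((1 - t) * \<phi> u + t * \<phi> v))"
          by (simp add: algebra_simps)
        also have "\<dots> \<le> ereal (a - \<phi> ((1 - t) *\<^sub>R u + t *\<^sub>R v))"
          using convex_onD[OF cv t, of u v] by simp
        finally show ?thesis
          by (simp add: C_def a_def)
      qed
    qed
  next
    show "decseq C"
      unfolding decseq_def
    proof (intro allI impI subsetI)
      fix i j :: nat and u assume ij: "i \<le> j" and u: "u \<in> C j"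
      have "1 / real (Suc j) \<le> 1 / Suc i"
        using ij by (intro divide_left_mono) auto
      then have "ereal (c + 1 / Suc j - \<phi> u) \<le> ereal (c + 1 / Suc i - \<phi> u)"
        by simp
      with u show "u \<in> C i"
        unfolding C_def using order_trans by blast
    qed
    have "norm u \<le> (c + 1 - b) / \<omega>" if "u \<in> C 0" for u
    proof -
      have "ereal (\<omega> * norm u) \<le> ereal (c + 1 - \<phi> u)"
        using that by (intro order_trans[OF coercive[of u]]) (simp add: C_def)
      then show ?thesis
        using b[of u] pos by (simp add: field_simps)
    qed
    then show "bounded (C 0)"
      by (auto simp: bounded_iff)
  qed
  then obtain p where p: "\<And>n. p \<in> C n"
    by blast
  have "g p + ereal (\<phi> p) \<le> ereal c"
  proof (rule ereal_le_epsilon2)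
    fix \<epsilon> :: real assume "0 < \<epsilon>"
    then obtain n where "1 / real (Suc n) < \<epsilon>"
      using reals_Archimedean unfolding inverse_eq_divide by blast
    then have "ereal (c + 1 / Suc n) \<le> ereal c + ereal \<epsilon>"
      by simp
    then show "g p + ereal (\<phi> p) \<le> ereal c + ereal \<epsilon>"
      using p[of n] unfolding C_iff by (rule order_trans[rotated])
  qed
  moreover have "ereal c \<le> g u + ereal (\<phi> u)" for u
    unfolding c[symmetric] m_def by (rule INF_lower) simp
  ultimately have "p \<in> argmin (\<lambda>u. g u + ereal (\<phi> u))"
    unfolding argmin_iff using order_trans by blast
  then show ?thesis
    by blast
qed

end

section \<open>Gradients of convex functions\<close>

lemma GDERIV_along_line:
  fixes \<phi> :: "'a::real_inner \<Rightarrow> real"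
  assumes "GDERIV \<phi> (p + t *\<^sub>R d) :> D"
  shows "((\<lambda>s. \<phi> (p + s *\<^sub>R d)) has_real_derivative d \<bullet> D) (at t)"
proof -
  have "((\<lambda>s. p + s *\<^sub>R d) has_derivative (\<lambda>s. s *\<^sub>R d)) (at t)"
    by (auto intro!: derivative_eq_intros)
  moreover have "(\<phi> has_derivative (\<lambda>v. v \<bullet> D)) (at (p + t *\<^sub>R d))"
    using assms by (simp add: gderiv_def)
  ultimately have "((\<lambda>s. \<phi> (p + s *\<^sub>R d)) has_derivative (\<lambda>s. (s *\<^sub>R d) \<bullet> D)) (at t)"
    by (rule has_derivative_compose)
  then show ?thesis
    by (simp add: has_field_derivative_def mult.commute[of _ "d \<bullet> D"])
qed

text \<open>Both the gradient inequality for convex functions and the first-order optimality condition are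
instances: in each case convexity bounds the difference quotients along a segment.\<close>

lemma le_directional_derivative:
  fixes \<phi> :: "'a::real_inner \<Rightarrow> real"
  assumes D: "GDERIV \<phi> p :> D"
    and le: "\<And>t. 0 < t \<Longrightarrow> t < 1 \<Longrightarrow> c * t \<le> \<phi> (p + t *\<^sub>R d) - \<phi> p"
  shows "c \<le> d \<bullet> D"
proof -
  have "((\<lambda>s. \<phi> (p + s *\<^sub>R d)) has_real_derivative d \<bullet> D) (at 0)"
    using D by (intro GDERIV_along_line) simp
  then have "((\<lambda>t. (\<phi> (p + t *\<^sub>R d) - \<phi> p) / t) \<longlongrightarrow> d \<bullet> D) (at 0)"
    by (simp add: has_field_derivative_iff)
  then have lim: "((\<lambda>t. (\<phi> (p + t *\<^sub>R d) - \<phi> p) / t) \<longlongrightarrow> d \<bullet> D) (at_right 0)"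
    by (rule filterlim_mono) (auto simp: at_le)
  have "eventually (\<lambda>t::real. t \<in> {0<..<1}) (at_right 0)"
    by (rule eventually_at_right_real) simp
  then have "eventually (\<lambda>t. c \<le> (\<phi> (p + t *\<^sub>R d) - \<phi> p) / t) (at_right 0)"
    by (rule eventually_mono) (use le in \<open>auto simp: field_simps\<close>)
  with lim show ?thesis
    by (rule tendsto_lowerbound) simp
qed

lemma convex_on_gradient_inequality:
  fixes \<phi> :: "'a::real_inner \<Rightarrow> real"
  assumes cv: "convex_on UNIV \<phi>" and D: "GDERIV \<phi> p :> D"
  shows "\<phi> p + (u - p) \<bullet> D \<le> \<phi> u"
proof -
  have "\<phi> p - \<phi> u \<le> (u - p) \<bullet> (- D)"
  proof (rule le_directional_derivative)
    show "GDERIV (\<lambda>v. - \<phi> v) p :> - D"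
      using D by (rule GDERIV_minus)
    fix t :: real assume t: "0 < t" "t < 1"
    have "\<phi> ((1 - t) *\<^sub>R p + t *\<^sub>R u) \<le> (1 - t) * \<phi> p + t * \<phi> u"
      using t by (intro convex_onD[OF cv]) auto
    moreover have "(1 - t) *\<^sub>R p + t *\<^sub>R u = p + t *\<^sub>R (u - p)"
      by (simp add: algebra_simps)
    ultimately show "(\<phi> p - \<phi> u) * t \<le> - \<phi> (p + t *\<^sub>R (u - p)) - - \<phi> p"
      by (simp add: algebra_simps)
  qed
  then show ?thesis
    by simp
qed

text \<open>Along the segment, the difference between the two sides of the claim, as a function of \<open>t\<close>, has
nonpositive derivative by the Lipschitz condition; this avoids integrating the gradient.\<close>

lemma descent_lemma:
  fixes h :: "'a::real_inner \<Rightarrow> real"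
  assumes D: "\<And>u. GDERIV h u :> G u" and lip: "L-lipschitz_on UNIV G"
  shows "h (u + d) \<le> h u + d \<bullet> G u + L / 2 * (norm d)\<^sup>2"
proof -
  define q where "q t = h (u + t *\<^sub>R d) - t * (d \<bullet> G u) - L / 2 * (norm d)\<^sup>2 * t\<^sup>2" for t
  have "q 1 \<le> q 0"
  proof (rule DERIV_nonpos_imp_nonincreasing[of 0 1 q])
    fix t :: real assume t: "0 \<le> t" "t \<le> 1"
    have "DERIV q t :> d \<bullet> G (u + t *\<^sub>R d) - d \<bullet> G u - L / 2 * (norm d)\<^sup>2 * (2 * t)"
      unfolding q_def by (auto intro!: derivative_eq_intros GDERIV_along_line D)
    moreover have "d \<bullet> (G (u + t *\<^sub>R d) - G u) \<le> norm d * norm (G (u + t *\<^sub>R d) - G u)"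
      by (rule norm_cauchy_schwarz)
    moreover have "norm (G (u + t *\<^sub>R d) - G u) \<le> L * (t * norm d)"
      using lipschitz_onD[OF lip, of "u + t *\<^sub>R d" u] t by (simp add: dist_norm)
    then have "norm d * norm (G (u + t *\<^sub>R d) - G u) \<le> norm d * (L * (t * norm d))"
      by (rule mult_left_mono) simp
    ultimately show "\<exists>y. DERIV q t :> y \<and> y \<le> 0"
      by (intro exI[of _ "d \<bullet> G (u + t *\<^sub>R d) - d \<bullet> G u - L / 2 * (norm d)\<^sup>2 * (2 * t)"])
        (simp add: inner_diff_right power2_eq_square algebra_simps)
  qed simp
  then show ?thesis
    by (simp add: q_def)
qed

text \<open>Compare the gradient inequality at \<open>v\<close> with the descent lemma at \<open>u\<close>, both evaluated at the endpoint
of the gradient step of size \<open>1/L\<close> from \<open>u\<close> for the convex function \<open>h - \<langle>\<nabla>h(v), \<cdot>\<rangle>\<close>, which is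
minimized by \<open>v\<close>.\<close>

lemma strengthened_gradient_inequality:
  fixes h :: "'a::real_inner \<Rightarrow> real"
  assumes D: "\<And>u. GDERIV h u :> G u" and cv: "convex_on UNIV h"
    and lip: "L-lipschitz_on UNIV G" and L: "0 < L"
  shows "h v + (u - v) \<bullet> G v + 1 / (2 * L) * (norm (G u - G v))\<^sup>2 \<le> h u"
proof -
  define z where "z = G u - G v"
  have "h v + (u + (-1/L) *\<^sub>R z - v) \<bullet> G v \<le> h (u + (-1/L) *\<^sub>R z)"
    by (rule convex_on_gradient_inequality[OF cv D])
  also have "\<dots> \<le> h u + ((-1/L) *\<^sub>R z) \<bullet> G u + L / 2 * (norm ((-1/L) *\<^sub>R z))\<^sup>2"
    by (rule descent_lemma[OF D lip])
  also have "(norm ((-1/L) *\<^sub>R z))\<^sup>2 = (1/L)\<^sup>2 * (norm z)\<^sup>2"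
    by (simp add: power_mult_distrib power_divide)
  finally have le: "h v + (u + (-1/L) *\<^sub>R z - v) \<bullet> G v
      \<le> h u + ((-1/L) *\<^sub>R z) \<bullet> G u + L / 2 * ((1/L)\<^sup>2 * (norm z)\<^sup>2)" .
  have step: "(u + (-1/L) *\<^sub>R z - v) \<bullet> G v = (u - v) \<bullet> G v - 1/L * (z \<bullet> G v)"
    by (simp add: inner_add_left inner_diff_left)
  have z: "(norm z)\<^sup>2 = z \<bullet> G u - z \<bullet> G v"
    by (simp add: z_def power2_norm_eq_inner inner_diff_right)
  have "L / 2 * ((1/L)\<^sup>2 * (norm z)\<^sup>2) = 1 / (2 * L) * (norm z)\<^sup>2"
    using L by (simp add: power2_eq_square)
  moreover have "1 / L * (norm z)\<^sup>2 = 2 * (1 / (2 * L) * (norm z)\<^sup>2)"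
    by simp
  moreover have "1 / L * (norm z)\<^sup>2 = 1 / L * (z \<bullet> G u) - 1 / L * (z \<bullet> G v)"
    unfolding z by (rule right_diff_distrib)
  moreover have "((-1/L) *\<^sub>R z) \<bullet> G u = - (1 / L * (z \<bullet> G u))"
    by simp
  ultimately show ?thesis
    using le unfolding step z_def[symmetric] by linarith
qed

text \<open>The theorem of Baillon and Haddad: add the strengthened gradient inequality to itself with \<open>u\<close> and
\<open>v\<close> exchanged.\<close>

lemma gradient_cocoercive:
  fixes h :: "'a::real_inner \<Rightarrow> real"
  assumes D: "\<And>u. GDERIV h u :> G u" and cv: "convex_on UNIV h"
    and lip: "L-lipschitz_on UNIV G" and L: "0 < L"
  shows "1 / L * (norm (G u - G v))\<^sup>2 \<le> (u - v) \<bullet> (G u - G v)"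
proof -
  have "1 / L * (norm (G u - G v))\<^sup>2 = 2 * (1 / (2 * L) * (norm (G u - G v))\<^sup>2)"
    by simp
  moreover have "(u - v) \<bullet> (G u - G v) = - ((u - v) \<bullet> G v) - (v - u) \<bullet> G u"
    by (simp add: inner_diff_left inner_diff_right)
  ultimately show ?thesis
    using strengthened_gradient_inequality[OF assms, of u v] strengthened_gradient_inequality[OF assms, of v u]
    unfolding norm_minus_commute[of "G v" "G u"] by linarith
qed

lemma gradient_step_estimate:
  fixes h :: "'a::real_inner \<Rightarrow> real"
  assumes D: "\<And>u. GDERIV h u :> G u" and cv: "convex_on UNIV h"
    and lip: "L-lipschitz_on UNIV G" and L: "0 < L" and \<gamma>: "0 < \<gamma>"
  shows "(norm ((u - \<gamma> *\<^sub>R G u) - (v - \<gamma> *\<^sub>R G v)))\<^sup>2 + \<gamma> * (2 / L - \<gamma>) * (norm (G u - G v))\<^sup>2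
         \<le> (norm (u - v))\<^sup>2"
proof -
  define a where "a = u - v"
  define b where "b = G u - G v"
  have diff: "(u - \<gamma> *\<^sub>R G u) - (v - \<gamma> *\<^sub>R G v) = a - \<gamma> *\<^sub>R b"
    by (simp add: a_def b_def algebra_simps)
  have "(norm (a - \<gamma> *\<^sub>R b))\<^sup>2 = (norm a)\<^sup>2 - 2 * \<gamma> * (a \<bullet> b) + \<gamma>\<^sup>2 * (norm b)\<^sup>2"
    unfolding power2_norm_eq_inner
    by (simp add: inner_diff_left inner_diff_right inner_commute[of b a] power2_eq_square
        right_diff_distrib)
  moreover have "2 * \<gamma> * (1 / L * (norm b)\<^sup>2) \<le> 2 * \<gamma> * (a \<bullet> b)"
    unfolding a_def b_def
    using gradient_cocoercive[OF D cv lip L, of u v] \<gamma> by (intro mult_left_mono) auto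
  moreover have "\<gamma> * (2 / L - \<gamma>) * (norm b)\<^sup>2
      = 2 * \<gamma> * (1 / L * (norm b)\<^sup>2) - \<gamma>\<^sup>2 * (norm b)\<^sup>2"
    by (simp add: power2_eq_square algebra_simps)
  ultimately show ?thesis
    unfolding diff unfolding a_def[symmetric] b_def[symmetric] by linarith
qed

section \<open>Subgradients and the proximal map\<close>

text \<open>Finiteness at \<open>p\<close> is part of the notion: otherwise every vector would be a subgradient of a
function that is constantly \<open>\<infinity>\<close>.\<close>

definition is_subgradient :: "('a::real_inner \<Rightarrow> ereal) \<Rightarrow> 'a \<Rightarrow> 'a \<Rightarrow> bool" where
  "is_subgradient g p r \<longleftrightarrow> \<bar>g p\<bar> \<noteq> \<infinity> \<and> (\<forall>u. g p + ereal (r \<bullet> (u - p)) \<le> g u)"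

lemma is_subgradient_monotone:
  assumes "is_subgradient g p r" "is_subgradient g q s"
  shows "0 \<le> (r - s) \<bullet> (p - q)"
proof -
  obtain a b where ab: "g p = ereal a" "g q = ereal b"
    using assms by (auto simp: is_subgradient_def)
  have "g p + ereal (r \<bullet> (q - p)) \<le> g q" "g q + ereal (s \<bullet> (p - q)) \<le> g p"
    using assms by (simp_all add: is_subgradient_def)
  then have "a + r \<bullet> (q - p) \<le> b" "b + s \<bullet> (p - q) \<le> a"
    by (simp_all add: ab)
  then show ?thesis
    by (simp add: inner_diff_left inner_diff_right)
qed

lemma convex_on_norm_diff_squared:
  fixes y :: "'a::real_inner"
  assumes "0 \<le> c"
  shows "convex_on UNIV (\<lambda>u. c * (norm (u - y))\<^sup>2)"
proof (rule convex_onI)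
  fix t :: real and u v :: 'a
  assume t: "0 < t" "t < 1"
  define a b where "a = u - y" and "b = v - y"
  have split: "(1 - t) *\<^sub>R u + t *\<^sub>R v - y = (1 - t) *\<^sub>R a + t *\<^sub>R b"
    by (simp add: a_def b_def algebra_simps)
  have "(1 - t) * (norm a)\<^sup>2 + t * (norm b)\<^sup>2 - (norm ((1 - t) *\<^sub>R a + t *\<^sub>R b))\<^sup>2
      = t * (1 - t) * (norm (a - b))\<^sup>2"
    unfolding power2_norm_eq_inner
    by (simp add: inner_diff_left inner_diff_right inner_add_left inner_add_right
        inner_commute[of b a]) (simp add: algebra_simps)
  moreover have "0 \<le> t * (1 - t) * (norm (a - b))\<^sup>2"
    using t by simp
  ultimately have "(norm ((1 - t) *\<^sub>R a + t *\<^sub>R b))\<^sup>2 \<le> (1 - t) * (norm a)\<^sup>2 + t * (norm b)\<^sup>2"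
    by linarith
  from mult_left_mono[OF this assms]
  show "c * (norm ((1 - t) *\<^sub>R u + t *\<^sub>R v - y))\<^sup>2
      \<le> (1 - t) * (c * (norm (u - y))\<^sup>2) + t * (c * (norm (v - y))\<^sup>2)"
    unfolding split a_def[symmetric] b_def[symmetric] by (simp add: distrib_left mult.left_commute)
qed simp

lemma GDERIV_norm_diff_squared:
  fixes y :: "'a::real_inner"
  shows "GDERIV (\<lambda>u. c * (norm (u - y))\<^sup>2) p :> (2 * c) *\<^sub>R (p - y)"
proof -
  have "((\<lambda>u. c * ((u - y) \<bullet> (u - y))) has_derivative (\<lambda>v. c * ((p - y) \<bullet> v + v \<bullet> (p - y)))) (at p)"
    by (auto intro!: derivative_eq_intros)
  moreover have "(\<lambda>v. c * ((p - y) \<bullet> v + v \<bullet> (p - y))) = (\<lambda>v. v \<bullet> ((2 * c) *\<^sub>R (p - y)))"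
    by (simp add: fun_eq_iff inner_commute[of "p - y"])
  ultimately show ?thesis
    by (simp add: gderiv_def power2_norm_eq_inner)
qed

text \<open>Expand \<open>y - w\<close> as the sum of \<open>p - q\<close> and the difference of the residuals; the cross term is
nonnegative because subgradients are monotone. The case \<open>y = w\<close> gives uniqueness of the proximal
point.\<close>

lemma prox_firmly_nonexpansive:
  fixes p q y w :: "'a::real_inner"
  assumes "is_subgradient g p ((1 / \<gamma>) *\<^sub>R (y - p))" "is_subgradient g q ((1 / \<gamma>) *\<^sub>R (w - q))"
    and \<gamma>: "0 < \<gamma>"
  shows "(norm (p - q))\<^sup>2 + (norm ((y - p) - (w - q)))\<^sup>2 \<le> (norm (y - w))\<^sup>2"
proof -
  define a b where "a = p - q" and "b = (y - p) - (w - q)"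
  have "0 \<le> ((1 / \<gamma>) *\<^sub>R (y - p) - (1 / \<gamma>) *\<^sub>R (w - q)) \<bullet> (p - q)"
    using assms(1,2) by (rule is_subgradient_monotone)
  also have "\<dots> = (1 / \<gamma>) * (b \<bullet> a)"
    by (simp add: a_def b_def scaleR_diff_right[symmetric])
  finally have "0 \<le> b \<bullet> a"
    using \<gamma> by (simp add: zero_le_divide_iff)
  moreover have "y - w = a + b"
    by (simp add: a_def b_def)
  ultimately show ?thesis
    unfolding a_def[symmetric] b_def[symmetric]
    by (simp add: power2_norm_eq_inner inner_add_left inner_add_right inner_commute[of a b])
qed

context coercive_convex
begin

lemma not_MInf: "g u \<noteq> - \<infinity>"
  using nonneg[of u] by auto

text \<open>If \<open>p\<close> is a minimizer, then moving from \<open>p\<close> towards \<open>u\<close> by \<open>t\<close> changes \<open>g\<close> by at most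
\<open>t (g(u) - g(p))\<close>, so \<open>\<phi>\<close> must change by at least the negative of this, which is a bound for its
directional derivative. The converse adds the two affine minorants.\<close>

lemma argmin_add_iff_subgradient:
  assumes cv: "convex_on UNIV \<phi>" and D: "GDERIV \<phi> p :> D"
  shows "p \<in> argmin (\<lambda>u. g u + ereal (\<phi> u)) \<longleftrightarrow> is_subgradient g p (- D)"
proof
  assume "p \<in> argmin (\<lambda>u. g u + ereal (\<phi> u))"
  then have min: "\<And>u. g p + ereal (\<phi> p) \<le> g u + ereal (\<phi> u)"
    by (simp add: argmin_iff)
  have "g p + ereal (\<phi> p) \<le> ereal (\<phi> 0)"
    using min[of 0] zero by simp
  then obtain a where a: "g p = ereal a"
    using not_MInf[of p] by (cases "g p") auto
  have "g p + ereal ((- D) \<bullet> (u - p)) \<le> g u" for u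
  proof (cases "g u")
    case (real b)
    have "a - b \<le> (u - p) \<bullet> D"
    proof (rule le_directional_derivative[OF D])
      fix t :: real assume t: "0 < t" "t < 1"
      have eq: "(1 - t) *\<^sub>R p + t *\<^sub>R u = p + t *\<^sub>R (u - p)"
        by (simp add: algebra_simps)
      have "g (p + t *\<^sub>R (u - p)) \<le> ereal ((1 - t) * a + t * b)"
        using convex_fun_combination_le[OF convex t, of p a u b] a real by (simp add: eq)
      then have "g p + ereal (\<phi> p) \<le> ereal ((1 - t) * a + t * b) + ereal (\<phi> (p + t *\<^sub>R (u - p)))"
        by (intro order_trans[OF min add_right_mono])
      then show "(a - b) * t \<le> \<phi> (p + t *\<^sub>R (u - p)) - \<phi> p"
        by (simp add: a algebra_simps)
    qed
    then show ?thesis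
      by (simp add: a real inner_commute[of D])
  qed (use not_MInf in auto)
  then show "is_subgradient g p (- D)"
    by (simp add: is_subgradient_def a)
next
  assume sub: "is_subgradient g p (- D)"
  then obtain a where a: "g p = ereal a"
    by (auto simp: is_subgradient_def)
  have "g p + ereal (\<phi> p) \<le> g u + ereal (\<phi> u)" for u
  proof -
    have "g p + ereal (\<phi> p) \<le> (g p + ereal ((- D) \<bullet> (u - p))) + ereal (\<phi> u)"
      using convex_on_gradient_inequality[OF cv D, of u] by (simp add: a inner_commute[of D])
    also have "\<dots> \<le> g u + ereal (\<phi> u)"
      using sub by (intro add_right_mono) (simp add: is_subgradient_def)
    finally show ?thesis .
  qed
  then show "p \<in> argmin (\<lambda>u. g u + ereal (\<phi> u))"
    by (simp add: argmin_iff)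
qed

lemma prox_eq_iff_subgradient:
  assumes \<gamma>: "0 < \<gamma>"
  shows "prox \<gamma> g y = p \<longleftrightarrow> is_subgradient g p ((1 / \<gamma>) *\<^sub>R (y - p))"
proof -
  define \<phi> where "\<phi> u = 1 / (2 * \<gamma>) * (norm (u - y))\<^sup>2" for u
  have cv: "convex_on UNIV \<phi>"
    unfolding \<phi>_def using \<gamma> by (intro convex_on_norm_diff_squared) simp
  have D: "GDERIV \<phi> q :> - ((1 / \<gamma>) *\<^sub>R (y - q))" for q
  proof -
    have "(2 * (1 / (2 * \<gamma>))) *\<^sub>R (q - y) = - ((1 / \<gamma>) *\<^sub>R (y - q))"
      unfolding scaleR_minus_right[symmetric] minus_diff_eq by simp
    then show ?thesis
      unfolding \<phi>_def using GDERIV_norm_diff_squared[of "1 / (2 * \<gamma>)" y q] by metis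
  qed
  have argmin: "q \<in> argmin (\<lambda>u. g u + ereal (\<phi> u)) \<longleftrightarrow> is_subgradient g q ((1 / \<gamma>) *\<^sub>R (y - q))" for q
    using argmin_add_iff_subgradient[OF cv D] unfolding minus_minus .
  have unique: "q = q'"
    if "is_subgradient g q ((1 / \<gamma>) *\<^sub>R (y - q))" "is_subgradient g q' ((1 / \<gamma>) *\<^sub>R (y - q'))" for q q'
  proof -
    have "(norm (q - q'))\<^sup>2 + (norm ((y - q) - (y - q')))\<^sup>2 \<le> 0"
      using prox_firmly_nonexpansive[OF that \<gamma>] by (simp only: diff_self norm_zero zero_power2)
    then have "norm (q - q') = 0"
      unfolding sum_power2_le_zero_iff by (rule conjunct1)
    then show ?thesis
      by simp
  qed
  have "continuous_on UNIV \<phi>"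
    unfolding \<phi>_def by (intro continuous_intros)
  moreover have "bdd_below (range \<phi>)"
    unfolding \<phi>_def by (rule bdd_belowI2[of _ 0]) (use \<gamma> in simp)
  ultimately obtain q where q: "is_subgradient g q ((1 / \<gamma>) *\<^sub>R (y - q))"
    using ex_argmin_add[OF cv] argmin by blast
  have "prox \<gamma> g y = (THE q. is_subgradient g q ((1 / \<gamma>) *\<^sub>R (y - q)))"
    unfolding prox_def argmin[symmetric] \<phi>_def by (rule refl)
  also have "\<dots> = q"
    using q by (rule the_equality) (rule unique[OF _ q])
  finally have "prox \<gamma> g y = q" .
  then show ?thesis
    using q unique by metis
qed

end

section \<open>The proximal gradient iteration\<close>

locale proximal_gradient = coercive_convex g \<omega>
  for g :: "'a::{real_inner, banach} \<Rightarrow> ereal" and \<omega> +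
  fixes h :: "'a \<Rightarrow> real" and grad_h :: "'a \<Rightarrow> 'a" and L \<gamma> :: real
  assumes h_convex: "convex_on UNIV h" and h_bdd_below: "bdd_below (range h)"
    and h_gradient: "\<And>u. GDERIV h u :> grad_h u"
    and L_pos: "0 < L" and grad_lipschitz: "L-lipschitz_on UNIV grad_h"
    and step_size: "0 < \<gamma>" "\<gamma> < 2 / L"
begin

definition step :: "'a \<Rightarrow> 'a" where
  "step u = prox \<gamma> g (u - \<gamma> *\<^sub>R grad_h u)"

definition resid :: "'a \<Rightarrow> 'a" where
  "resid u = u - \<gamma> *\<^sub>R grad_h u - step u"

lemma resid_subgradient: "is_subgradient g (step u) ((1 / \<gamma>) *\<^sub>R resid u)"
  unfolding resid_def step_def using prox_eq_iff_subgradient[OF step_size(1)] by blast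

text \<open>The two nonnegative terms next to \<open>\<parallel>step u - step v\<parallel>\<^sup>2\<close> are what an iteration gains beyond
nonexpansiveness. The first drives finite support, and both drive asymptotic regularity.\<close>

lemma step_estimate:
  "(norm (step u - step v))\<^sup>2 + (norm (resid u - resid v))\<^sup>2
     + \<gamma> * (2 / L - \<gamma>) * (norm (grad_h u - grad_h v))\<^sup>2 \<le> (norm (u - v))\<^sup>2"
  using prox_firmly_nonexpansive[OF resid_subgradient[of u, unfolded resid_def]
      resid_subgradient[of v, unfolded resid_def] step_size(1)]
    gradient_step_estimate[OF h_gradient h_convex grad_lipschitz L_pos step_size(1), of u v]
  unfolding resid_def by linarith

lemma step_nonexpansive: "norm (step u - step v) \<le> norm (u - v)"
proof (rule power2_le_imp_le)
  have "0 \<le> \<gamma> * (2 / L - \<gamma>) * (norm (grad_h u - grad_h v))\<^sup>2"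
    using step_size by simp
  then show "(norm (step u - step v))\<^sup>2 \<le> (norm (u - v))\<^sup>2"
    using step_estimate[of u v] zero_le_power2[of "norm (resid u - resid v)"] by linarith
qed simp

lemma step_fixed_iff_argmin: "step z = z \<longleftrightarrow> z \<in> argmin (\<lambda>u. g u + ereal (h u))"
proof -
  have "step z = z \<longleftrightarrow> is_subgradient g z ((1 / \<gamma>) *\<^sub>R ((z - \<gamma> *\<^sub>R grad_h z) - z))"
    unfolding step_def by (rule prox_eq_iff_subgradient[OF step_size(1)])
  also have "(1 / \<gamma>) *\<^sub>R ((z - \<gamma> *\<^sub>R grad_h z) - z) = - grad_h z"
    using step_size by simp
  finally show ?thesis
    using argmin_add_iff_subgradient[OF h_convex h_gradient] by simp
qed

lemma ex_fixed_point: "\<exists>z. step z = z"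
proof -
  have "continuous_on UNIV h"
    using has_derivative_continuous[OF h_gradient[unfolded gderiv_def]]
    by (simp add: continuous_on_eq_continuous_at)
  then show ?thesis
    unfolding step_fixed_iff_argmin by (rule ex_argmin_add[OF h_convex _ h_bdd_below])
qed

lemma isCont_step: "isCont step u"
proof -
  have "1-lipschitz_on UNIV step"
    using step_nonexpansive by (intro lipschitz_onI) (auto simp: dist_norm)
  then show ?thesis
    using lipschitz_on_continuous_on continuous_on_eq_continuous_at by blast
qed

context
  fixes x :: "nat \<Rightarrow> 'a" and z :: 'a
  assumes iter: "\<And>n. x (Suc n) = step (x n)" and fixed: "step z = z"
begin

lemma energy_bound:
  "(\<Sum>i<n. (norm (resid (x i) - resid z))\<^sup>2 + \<gamma> * (2 / L - \<gamma>) * (norm (grad_h (x i) - grad_h z))\<^sup>2)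
     + (norm (x n - z))\<^sup>2 \<le> (norm (x 0 - z))\<^sup>2"
proof (induction n)
  case (Suc n)
  then show ?case
    using step_estimate[of "x n" z] by (simp add: iter fixed)
qed simp

lemma resid_sum_bound: "(\<Sum>i<n. (norm (resid (x i) - resid z))\<^sup>2) \<le> (norm (x 0 - z))\<^sup>2"
proof -
  have "(\<Sum>i<n. (norm (resid (x i) - resid z))\<^sup>2) \<le> (\<Sum>i<n. (norm (resid (x i) - resid z))\<^sup>2
      + \<gamma> * (2 / L - \<gamma>) * (norm (grad_h (x i) - grad_h z))\<^sup>2)"
    using step_size by (intro sum_mono) simp
  then show ?thesis
    using energy_bound[of n] zero_le_power2[of "norm (x n - z)"] by linarith
qed

lemma dist_fixed_antimono: "m \<le> n \<Longrightarrow> norm (x n - z) \<le> norm (x m - z)"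
proof (induction n rule: dec_induct)
  case (step n)
  then show ?case
    using step_nonexpansive[of "x n" z] by (simp add: iter fixed)
qed simp

text \<open>Asymptotic regularity: both the residuals and the gradients converge to their values at \<open>z\<close>, by
summability of the terms that the step estimate gains, and \<open>x\<^bsup>n+1\<^esup> - x\<^bsup>n\<^esup>\<close> is a linear combination
of these two differences since \<open>r(z) = - \<gamma> \<nabla>h(z)\<close>.\<close>

lemma successive_diff_tendsto_0: "(\<lambda>n. x (Suc n) - x n) \<longlonglongrightarrow> 0"
proof -
  define a where "a n = (norm (resid (x n) - resid z))\<^sup>2" for n
  define b where "b n = \<gamma> * (2 / L - \<gamma>) * (norm (grad_h (x n) - grad_h z))\<^sup>2" for n
  have nonneg: "0 \<le> a n" "0 \<le> b n" for n
    using step_size by (auto simp: a_def b_def)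
  have sum: "summable (\<lambda>n. a n + b n)"
  proof (rule bounded_imp_summable)
    show "(\<Sum>k\<le>n. a k + b k) \<le> (norm (x 0 - z))\<^sup>2" for n
      using energy_bound[of "Suc n"] zero_le_power2[of "norm (x (Suc n) - z)"]
      unfolding a_def b_def lessThan_Suc_atMost by linarith
  qed (use nonneg in \<open>simp add: add_nonneg_nonneg\<close>)
  have lim: "(\<lambda>n. a n + b n) \<longlonglongrightarrow> 0"
    using sum by (rule summable_LIMSEQ_zero)
  have "a \<longlonglongrightarrow> 0" "b \<longlonglongrightarrow> 0"
    by (rule tendsto_sandwich[OF _ _ tendsto_const lim]; use nonneg in \<open>simp add: eventually_sequentially\<close>)+
  have r: "(\<lambda>n. resid (x n) - resid z) \<longlonglongrightarrow> 0"
    using tendsto_real_sqrt[OF \<open>a \<longlonglongrightarrow> 0\<close>] by (simp add: a_def tendsto_norm_zero_iff)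
  have "(\<lambda>n. b n / (\<gamma> * (2 / L - \<gamma>))) \<longlonglongrightarrow> 0 / (\<gamma> * (2 / L - \<gamma>))"
    using step_size by (intro tendsto_divide[OF \<open>b \<longlonglongrightarrow> 0\<close> tendsto_const]) simp
  then have "(\<lambda>n. (norm (grad_h (x n) - grad_h z))\<^sup>2) \<longlonglongrightarrow> 0"
    using step_size by (simp add: b_def)
  from tendsto_real_sqrt[OF this] have d: "(\<lambda>n. grad_h (x n) - grad_h z) \<longlonglongrightarrow> 0"
    by (simp add: tendsto_norm_zero_iff)
  have "(\<lambda>n. - (resid (x n) - resid z) - \<gamma> *\<^sub>R (grad_h (x n) - grad_h z)) \<longlonglongrightarrow> - 0 - \<gamma> *\<^sub>R 0"
    by (intro tendsto_intros r d)
  moreover have "- (resid (x n) - resid z) - \<gamma> *\<^sub>R (grad_h (x n) - grad_h z) = x (Suc n) - x n" for n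
    by (simp add: resid_def iter fixed algebra_simps)
  ultimately show ?thesis
    by simp
qed

end

text \<open>Asymptotic regularity makes the cluster point fixed; monotonicity of the distance to a fixed point
then propagates closeness from one index to all later ones.\<close>

lemma cluster_point_is_limit:
  assumes iter: "\<And>n. x (Suc n) = step (x n)"
    and s: "strict_mono s" "(x \<circ> s) \<longlonglongrightarrow> l"
  shows "step l = l" "x \<longlonglongrightarrow> l"
proof -
  obtain z where z: "step z = z"
    using ex_fixed_point by blast
  have "(\<lambda>n. step (x (s n))) \<longlonglongrightarrow> step l"
    using s(2) by (intro isCont_tendsto_compose[OF isCont_step]) (simp add: o_def)
  moreover have "(\<lambda>n. x (Suc (s n)) - x (s n) + x (s n)) \<longlonglongrightarrow> 0 + l"
    using LIMSEQ_subseq_LIMSEQ[OF successive_diff_tendsto_0[where x = x, OF iter z] s(1)] s(2)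
    by (intro tendsto_add) (simp_all add: o_def)
  then have "(\<lambda>n. step (x (s n))) \<longlonglongrightarrow> l"
    by (simp add: iter)
  ultimately show l: "step l = l"
    by (rule LIMSEQ_unique)
  show "x \<longlonglongrightarrow> l"
  proof (rule metric_LIMSEQ_I)
    fix \<epsilon> :: real assume "0 < \<epsilon>"
    then obtain m where m: "dist (x (s m)) l < \<epsilon>"
      using metric_LIMSEQ_D[OF s(2)] by (auto simp: o_def)
    have "dist (x n) l < \<epsilon>" if "n \<ge> s m" for n
      using dist_fixed_antimono[where x = x, OF iter l that] m by (simp add: dist_norm)
    then show "\<exists>M. \<forall>n\<ge>M. dist (x n) l < \<epsilon>"
      by blast
  qed
qed

lemma iterates_bounded:
  assumes iter: "\<And>n. x (Suc n) = step (x n)"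
  shows "bounded (range x)"
proof -
  obtain z where z: "step z = z"
    using ex_fixed_point by blast
  have "dist z (x n) \<le> norm (x 0 - z)" for n
    using dist_fixed_antimono[where x = x, OF iter z, of 0 n] by (simp add: dist_norm norm_minus_commute)
  then show ?thesis
    unfolding bounded_def by blast
qed

end

section \<open>Separable penalties\<close>

locale separable_penalty =
  fixes N :: "nat set" and e :: "nat \<Rightarrow> 'a::{real_inner, banach}"
    and G :: "nat \<Rightarrow> real \<Rightarrow> ereal" and \<omega> :: real and g :: "'a \<Rightarrow> ereal"
  assumes basis: "orthonormal_basis N e"
    and G_convex: "\<And>k. k \<in> N \<Longrightarrow> convex_fun (G k)"
    and G_le_liminf: "\<And>k X l. k \<in> N \<Longrightarrow> X \<longlonglongrightarrow> l \<Longrightarrow> G k l \<le> liminf (\<lambda>n. G k (X n))"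
    and G_zero: "\<And>k. k \<in> N \<Longrightarrow> G k 0 = 0"
    and \<omega>_pos: "0 < \<omega>"
    and G_lower: "\<And>k t. k \<in> N \<Longrightarrow> ereal (\<omega> * \<bar>t\<bar>) \<le> G k t"
    and g_eq_infsum: "\<And>u. g u = (\<Sum>\<^sub>\<infinity>k\<in>N. G k (u \<bullet> e k))"
begin

lemma orthonormal: "\<forall>i\<in>N. \<forall>j\<in>N. e i \<bullet> e j = (if i = j then 1 else 0)"
  using basis by (simp add: orthonormal_basis_def)

lemma G_nonneg: "k \<in> N \<Longrightarrow> 0 \<le> G k t"
proof -
  assume "k \<in> N"
  have "0 \<le> ereal (\<omega> * \<bar>t\<bar>)"
    using \<omega>_pos by simp
  also have "\<dots> \<le> G k t"
    using \<open>k \<in> N\<close> by (rule G_lower)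
  finally show ?thesis .
qed

text \<open>Since the terms are nonnegative, \<open>g\<close> is a supremum of finite sums; convexity and lower
semicontinuity are inherited from these.\<close>

lemma g_eq_SUP: "g u = (SUP F\<in>{F. finite F \<and> F \<subseteq> N}. \<Sum>k\<in>F. G k (u \<bullet> e k))"
  unfolding g_eq_infsum by (intro nonneg_infsum_complete G_nonneg)

lemma partial_sum_le_g: "finite F \<Longrightarrow> F \<subseteq> N \<Longrightarrow> (\<Sum>k\<in>F. G k (u \<bullet> e k)) \<le> g u"
  unfolding g_eq_SUP by (rule SUP_upper) simp

lemma g_le_if_partial_sums_le:
  assumes "\<And>F. finite F \<Longrightarrow> F \<subseteq> N \<Longrightarrow> (\<Sum>k\<in>F. G k (u \<bullet> e k)) \<le> c"
  shows "g u \<le> c"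
  unfolding g_eq_SUP using assms by (intro SUP_least) simp

lemma g_convex: "convex_fun g"
  unfolding convex_fun_def
proof (intro allI impI, elim conjE)
  fix u v and t :: real assume t: "0 < t" "t < 1"
  show "g ((1 - t) *\<^sub>R u + t *\<^sub>R v) \<le> ereal (1 - t) * g u + ereal t * g v"
  proof (rule g_le_if_partial_sums_le)
    fix F assume F: "finite F" "F \<subseteq> N"
    have "(\<Sum>k\<in>F. G k (((1 - t) *\<^sub>R u + t *\<^sub>R v) \<bullet> e k))
        \<le> (\<Sum>k\<in>F. ereal (1 - t) * G k (u \<bullet> e k) + ereal t * G k (v \<bullet> e k))"
    proof (rule sum_mono)
      fix k assume "k \<in> F"
      then have "convex_fun (G k)"
        using F(2) G_convex by blast
      then show "G k (((1 - t) *\<^sub>R u + t *\<^sub>R v) \<bullet> e k)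
          \<le> ereal (1 - t) * G k (u \<bullet> e k) + ereal t * G k (v \<bullet> e k)"
        using t by (simp add: convex_fun_def inner_add_left)
    qed
    also have "\<dots> = ereal (1 - t) * (\<Sum>k\<in>F. G k (u \<bullet> e k)) + ereal t * (\<Sum>k\<in>F. G k (v \<bullet> e k))"
      using F(2) G_nonneg by (simp add: sum.distrib sum_ereal_right_distrib subset_iff)
    also have "\<dots> \<le> ereal (1 - t) * g u + ereal t * g v"
      using t F by (intro add_mono ereal_mult_left_mono partial_sum_le_g) auto
    finally show "(\<Sum>k\<in>F. G k (((1 - t) *\<^sub>R u + t *\<^sub>R v) \<bullet> e k))
        \<le> ereal (1 - t) * g u + ereal t * g v" .
  qed
qed

lemma g_le_liminf:
  assumes X: "X \<longlonglongrightarrow> l"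
  shows "g l \<le> liminf (\<lambda>n. g (X n))"
proof (rule g_le_if_partial_sums_le)
  fix F assume F: "finite F" "F \<subseteq> N"
  have "(\<Sum>k\<in>F. G k (l \<bullet> e k)) \<le> liminf (\<lambda>n. \<Sum>k\<in>F. G k (X n \<bullet> e k))"
    using F
  proof (induction F)
    case empty
    show ?case
      by (simp add: Liminf_const)
  next
    case (insert j F)
    have "0 \<le> liminf (\<lambda>n. G j (X n \<bullet> e j))"
      using insert.prems G_nonneg by (intro Liminf_bounded always_eventually) auto
    moreover have "0 \<le> liminf (\<lambda>n. \<Sum>k\<in>F. G k (X n \<bullet> e k))"
      using insert.prems G_nonneg by (intro Liminf_bounded always_eventually allI sum_nonneg) auto
    ultimately have add: "liminf (\<lambda>n. G j (X n \<bullet> e j)) + liminf (\<lambda>n. \<Sum>k\<in>F. G k (X n \<bullet> e k))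
        \<le> liminf (\<lambda>n. G j (X n \<bullet> e j) + (\<Sum>k\<in>F. G k (X n \<bullet> e k)))"
      by (intro ereal_liminf_add_mono) auto
    have "G j (l \<bullet> e j) \<le> liminf (\<lambda>n. G j (X n \<bullet> e j))"
      using insert.prems X by (intro G_le_liminf tendsto_inner tendsto_const) auto
    then have "G j (l \<bullet> e j) + (\<Sum>k\<in>F. G k (l \<bullet> e k))
        \<le> liminf (\<lambda>n. G j (X n \<bullet> e j)) + liminf (\<lambda>n. \<Sum>k\<in>F. G k (X n \<bullet> e k))"
      using insert.IH insert.prems by (intro add_mono) auto
    also note add
    finally show ?case
      using insert.hyps by simp
  qed
  also have "\<dots> \<le> liminf (\<lambda>n. g (X n))"
    using F by (intro Liminf_mono always_eventually allI partial_sum_le_g)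
  finally show "(\<Sum>k\<in>F. G k (l \<bullet> e k)) \<le> liminf (\<lambda>n. g (X n))" .
qed

text \<open>The \<open>\<ell>\<^sup>1\<close> norm of the coordinates dominates the norm: this is the triangle inequality for a finite
expansion that approximates \<open>u\<close>.\<close>

lemma g_coercive: "ereal (\<omega> * norm u) \<le> g u"
proof (rule ereal_le_epsilon2)
  fix \<epsilon> :: real assume \<epsilon>: "0 < \<epsilon>"
  then have "0 < \<epsilon> / \<omega>"
    using \<omega>_pos by simp
  then obtain F where F: "finite F" "F \<subseteq> N"
      "norm (u - (\<Sum>k\<in>F. (u \<bullet> e k) *\<^sub>R e k)) < \<epsilon> / \<omega>"
    using orthonormal_basis_partial_sum_close[OF basis] by blast
  have "norm (e k) = 1" if "k \<in> F" for k
    using orthonormal F(2) that by (auto simp: norm_eq_sqrt_inner)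
  then have "norm (\<Sum>k\<in>F. (u \<bullet> e k) *\<^sub>R e k) \<le> (\<Sum>k\<in>F. \<bar>u \<bullet> e k\<bar>)"
    by (intro sum_norm_le) simp
  then have "norm u \<le> \<epsilon> / \<omega> + (\<Sum>k\<in>F. \<bar>u \<bullet> e k\<bar>)"
    using norm_triangle_sub[of u "\<Sum>k\<in>F. (u \<bullet> e k) *\<^sub>R e k"] F(3) by linarith
  then have "\<omega> * norm u \<le> \<omega> * (\<epsilon> / \<omega> + (\<Sum>k\<in>F. \<bar>u \<bullet> e k\<bar>))"
    using \<omega>_pos by (intro mult_left_mono) auto
  also have "\<dots> = (\<Sum>k\<in>F. \<omega> * \<bar>u \<bullet> e k\<bar>) + \<epsilon>"
    using \<omega>_pos by (simp add: distrib_left sum_distrib_left)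
  finally have "ereal (\<omega> * norm u) \<le> (\<Sum>k\<in>F. ereal (\<omega> * \<bar>u \<bullet> e k\<bar>)) + ereal \<epsilon>"
    by simp
  also have "\<dots> \<le> (\<Sum>k\<in>F. G k (u \<bullet> e k)) + ereal \<epsilon>"
    using F(2) by (intro add_right_mono sum_mono G_lower) auto
  also have "\<dots> \<le> g u + ereal \<epsilon>"
    using F(1,2) by (intro add_right_mono partial_sum_le_g)
  finally show "ereal (\<omega> * norm u) \<le> g u + ereal \<epsilon>" .
qed

lemma g_zero: "g 0 = 0"
  unfolding g_eq_infsum by (rule infsum_0) (simp add: G_zero)

sublocale coercive_convex g \<omega>
  by unfold_locales (auto intro: g_convex g_le_liminf \<omega>_pos g_coercive g_zero)

text \<open>Test the subgradient inequality at the vector \<open>u\<close> obtained from \<open>p\<close> by erasing its \<open>k\<close>-th coordinate: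
this lowers \<open>g\<close> by at least \<open>\<omega> \<bar>p\<^sub>k\<bar>\<close>, whereas the subgradient allows a decrease of at most
\<open>r\<^sub>k p\<^sub>k\<close>.\<close>

lemma subgradient_coordinate_ge:
  assumes sub: "is_subgradient g p r" and k: "k \<in> N" and pk: "p \<bullet> e k \<noteq> 0"
  shows "\<omega> \<le> \<bar>r \<bullet> e k\<bar>"
proof -
  define u where "u = p - (p \<bullet> e k) *\<^sub>R e k"
  have uk: "u \<bullet> e k = 0"
    using orthonormal k by (simp add: u_def inner_diff_left)
  have uj: "u \<bullet> e j = p \<bullet> e j" if "j \<in> N" "j \<noteq> k" for j
  proof -
    have "e k \<bullet> e j = 0"
      using orthonormal k that by simp
    then show ?thesis
      by (simp add: u_def inner_diff_left)
  qed
  obtain a where a: "g p = ereal a"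
    using sub by (auto simp: is_subgradient_def)
  have "g u \<le> g p - ereal (\<omega> * \<bar>p \<bullet> e k\<bar>)"
  proof (rule g_le_if_partial_sums_le)
    fix F assume F: "finite F" "F \<subseteq> N"
    have "(\<Sum>j\<in>F. G j (u \<bullet> e j)) \<le> (\<Sum>j\<in>insert k F. G j (u \<bullet> e j))"
      using F k G_nonneg by (intro sum_mono2) auto
    also have "\<dots> = (\<Sum>j\<in>F - {k}. G j (u \<bullet> e j))"
      using F k by (simp add: sum.insert_remove uk G_zero)
    also have "\<dots> = (\<Sum>j\<in>F - {k}. G j (p \<bullet> e j))"
      using F by (intro sum.cong) (auto simp: uj)
    finally have "(\<Sum>j\<in>F. G j (u \<bullet> e j)) + ereal (\<omega> * \<bar>p \<bullet> e k\<bar>)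
        \<le> (\<Sum>j\<in>F - {k}. G j (p \<bullet> e j)) + G k (p \<bullet> e k)"
      using k by (intro add_mono G_lower)
    also have "\<dots> = (\<Sum>j\<in>insert k F. G j (p \<bullet> e j))"
      using F by (simp add: sum.insert_remove add.commute)
    also have "\<dots> \<le> g p"
      using F k by (intro partial_sum_le_g) auto
    finally show "(\<Sum>j\<in>F. G j (u \<bullet> e j)) \<le> g p - ereal (\<omega> * \<bar>p \<bullet> e k\<bar>)"
      unfolding a by (cases "\<Sum>j\<in>F. G j (u \<bullet> e j)") auto
  qed
  moreover have "g p + ereal (r \<bullet> (u - p)) \<le> g u"
    using sub by (simp add: is_subgradient_def)
  ultimately have "g p + ereal (r \<bullet> (u - p)) \<le> g p - ereal (\<omega> * \<bar>p \<bullet> e k\<bar>)"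
    by (rule order_trans[rotated])
  then have "\<omega> * \<bar>p \<bullet> e k\<bar> \<le> (r \<bullet> e k) * (p \<bullet> e k)"
    by (simp add: a u_def mult.commute)
  also have "\<dots> \<le> \<bar>r \<bullet> e k\<bar> * \<bar>p \<bullet> e k\<bar>"
    by (metis abs_ge_self abs_mult)
  finally show ?thesis
    using pk by simp
qed

end

section \<open>Finite support identification\<close>

text \<open>Each index of the set contributes at least \<open>d\<^sup>2\<close> to the double sum of squared coordinates over all
\<open>v\<^sub>n\<close>, and by Bessel's inequality that sum is at most \<open>B\<close>.\<close>

lemma finite_large_coordinates:
  fixes e v :: "nat \<Rightarrow> 'a::real_inner"
  assumes on: "\<forall>i\<in>N. \<forall>j\<in>N. e i \<bullet> e j = (if i = j then 1 else 0)"
    and bound: "\<And>n. (\<Sum>i<n. (norm (v i))\<^sup>2) \<le> B" and d: "0 < d"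
  shows "finite {k \<in> N. \<exists>n. d \<le> \<bar>v n \<bullet> e k\<bar>}" (is "finite ?J")
proof -
  have "card H \<le> nat \<lceil>B / d\<^sup>2\<rceil>" if H: "H \<subseteq> ?J" "finite H" for H
  proof -
    have "\<forall>k\<in>H. \<exists>n. d \<le> \<bar>v n \<bullet> e k\<bar>"
      using H by blast
    then obtain m where m: "\<And>k. k \<in> H \<Longrightarrow> d \<le> \<bar>v (m k) \<bullet> e k\<bar>"
      by metis
    obtain M where M: "\<And>k. k \<in> H \<Longrightarrow> m k < M"
      using finite_nat_bounded[of "m ` H"] H(2) by auto
    have "real (card H) * d\<^sup>2 = (\<Sum>k\<in>H. d\<^sup>2)"
      by simp
    also have "\<dots> \<le> (\<Sum>k\<in>H. \<Sum>i<M. (v i \<bullet> e k)\<^sup>2)"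
    proof (rule sum_mono)
      fix k assume k: "k \<in> H"
      have "d\<^sup>2 \<le> (v (m k) \<bullet> e k)\<^sup>2"
        using m[OF k] d by (simp add: abs_le_square_iff[symmetric])
      also have "\<dots> \<le> (\<Sum>i<M. (v i \<bullet> e k)\<^sup>2)"
        using M[OF k] by (intro member_le_sum) auto
      finally show "d\<^sup>2 \<le> (\<Sum>i<M. (v i \<bullet> e k)\<^sup>2)" .
    qed
    also have "\<dots> = (\<Sum>i<M. \<Sum>k\<in>H. (v i \<bullet> e k)\<^sup>2)"
      by (rule sum.swap)
    also have "\<dots> \<le> (\<Sum>i<M. (norm (v i))\<^sup>2)"
      using H by (intro sum_mono bessel_inequality[OF on]) auto
    also have "\<dots> \<le> B"
      by (rule bound)
    finally have "real (card H) \<le> B / d\<^sup>2"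
      using d by (simp add: pos_le_divide_eq)
    then show ?thesis
      by linarith
  qed
  then show ?thesis
    by (intro conjunct1[OF finite_if_finite_subsets_card_bdd])
qed

locale separable_proximal_gradient =
  separable_penalty N e G \<omega> g + proximal_gradient g \<omega> h grad_h L \<gamma>
  for N :: "nat set" and e :: "nat \<Rightarrow> 'a::{real_inner, banach}" and G \<omega> g h grad_h L \<gamma>
begin

text \<open>A coordinate that is nonzero in some \<open>x\<^bsup>n+1\<^esup>\<close> has \<open>\<bar>r(x\<^bsup>n\<^esup>)\<^sub>k\<bar> \<ge> \<gamma>\<omega>\<close>, hence \<open>\<bar>r(z)\<^sub>k\<bar> \<ge> \<gamma>\<omega>/2\<close> or
\<open>\<bar>(r(x\<^bsup>n\<^esup>) - r(z))\<^sub>k\<bar> \<ge> \<gamma>\<omega>/2\<close>. All these vectors are square summable together.\<close>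

lemma iterates_finite_support:
  assumes iter: "\<And>n. x (Suc n) = step (x n)"
  shows "\<exists>J. finite J \<and> J \<subseteq> N \<and> (\<forall>n. x (Suc n) \<in> supp_subspace N e J)"
proof -
  obtain z where z: "step z = z"
    using ex_fixed_point by blast
  \<comment> \<open>Prepending \<open>resid z\<close> lets one finiteness argument handle both reasons for a coordinate
    to be large.\<close>
  define v where "v n = (case n of 0 \<Rightarrow> resid z | Suc i \<Rightarrow> resid (x i) - resid z)" for n
  define d where "d = \<gamma> * \<omega> / 2"
  define J where "J = {k \<in> N. \<exists>n. d \<le> \<bar>v n \<bullet> e k\<bar>}"
  have d: "0 < d"
    using step_size \<omega>_pos by (simp add: d_def)
  have "(\<Sum>i<n. (norm (v i))\<^sup>2) \<le> (norm (resid z))\<^sup>2 + (norm (x 0 - z))\<^sup>2" for n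
  proof -
    have "(\<Sum>i<n. (norm (v i))\<^sup>2) \<le> (\<Sum>i<Suc n. (norm (v i))\<^sup>2)"
      by simp
    also have "\<dots> = (norm (resid z))\<^sup>2 + (\<Sum>i<n. (norm (resid (x i) - resid z))\<^sup>2)"
      unfolding sum.lessThan_Suc_shift by (simp add: v_def)
    also have "\<dots> \<le> (norm (resid z))\<^sup>2 + (norm (x 0 - z))\<^sup>2"
      using resid_sum_bound[where x = x, OF iter z] by (rule add_left_mono)
    finally show ?thesis .
  qed
  then have "finite J"
    unfolding J_def by (rule finite_large_coordinates[OF orthonormal _ d])
  moreover have "x (Suc n) \<in> supp_subspace N e J" for n
  proof -
    have "k \<in> J" if k: "k \<in> N" and nz: "step (x n) \<bullet> e k \<noteq> 0" for k
    proof (rule ccontr)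
      assume "k \<notin> J"
      then have "\<bar>v 0 \<bullet> e k\<bar> < d" "\<bar>v (Suc n) \<bullet> e k\<bar> < d"
        using k by (auto simp: J_def not_le)
      moreover have "resid (x n) \<bullet> e k = v (Suc n) \<bullet> e k + v 0 \<bullet> e k"
        by (simp add: v_def inner_diff_left)
      ultimately have "\<bar>resid (x n) \<bullet> e k\<bar> < \<gamma> * \<omega>"
        unfolding d_def by linarith
      moreover have "\<omega> \<le> \<bar>((1 / \<gamma>) *\<^sub>R resid (x n)) \<bullet> e k\<bar>"
        by (rule subgradient_coordinate_ge[OF resid_subgradient k nz])
      then have "\<gamma> * \<omega> \<le> \<bar>resid (x n) \<bullet> e k\<bar>"
        using step_size by (simp add: abs_mult pos_le_divide_eq mult.commute)
      ultimately show False
        by simp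
    qed
    then show ?thesis
      by (auto simp: supp_subspace_def supp_def iter)
  qed
  ultimately show ?thesis
    by (intro exI[of _ J]) (auto simp: J_def)
qed

lemma iterates_converge:
  assumes iter: "\<And>n. x (Suc n) = step (x n)"
  shows "\<exists>l. step l = l \<and> x \<longlonglongrightarrow> l"
proof -
  \<comment> \<open>The starting point may have infinite support, so the subsequence is taken from the shifted
    iteration.\<close>
  define y where "y n = x (Suc n)" for n
  have iter_y: "y (Suc n) = step (y n)" for n
    by (simp add: y_def iter)
  obtain J where J: "finite J" "J \<subseteq> N" "\<forall>n. y n \<in> supp_subspace N e J"
    using iterates_finite_support[where x = x, OF iter] unfolding y_def by blast
  obtain l s where s: "strict_mono s" "(y \<circ> s) \<longlonglongrightarrow> l"
    by (rule bounded_supp_subspace_convergent_subseq[OF basis J(1,2) J(3)[rule_format]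
          iterates_bounded[where x = y, OF iter_y]])
  have "step l = l" "y \<longlonglongrightarrow> l"
    by (rule cluster_point_is_limit[where x = y, OF iter_y s])+
  then show ?thesis
    unfolding y_def using LIMSEQ_imp_Suc[of x l] by blast
qed

end

section \<open>Thresholding penalties\<close>

text \<open>Convexity gives \<open>\<psi>(s t) \<le> s \<psi>(t)\<close>, and \<open>\<psi>(s t) / s\<close> tends to \<open>t \<psi>'(0) = 0\<close> as \<open>s\<close> decreases to
\<open>0\<close>.\<close>

lemma convex_fun_stationary_nonneg:
  assumes cv: "convex_fun \<psi>" and "\<And>t. \<psi> t \<noteq> - \<infinity>" and zero: "\<psi> 0 = 0"
    and D: "has_finite_derivative \<psi> 0 0"
  shows "0 \<le> \<psi> t"
proof (cases "\<psi> t")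
  case (real b)
  have "- b \<le> t \<bullet> - 0"
  proof (rule le_directional_derivative)
    show "GDERIV (\<lambda>s. - real_of_ereal (\<psi> s)) 0 :> - 0"
      using D by (intro GDERIV_minus) (simp add: has_finite_derivative_def)
    fix s :: real assume s: "0 < s" "s < 1"
    have "\<psi> ((1 - s) *\<^sub>R 0 + s *\<^sub>R t) \<le> ereal ((1 - s) * 0 + s * b)"
      using zero real by (intro convex_fun_combination_le[OF cv s]) auto
    then have "\<psi> (0 + s *\<^sub>R t) \<le> ereal (s * b)"
      by simp
    then have "real_of_ereal (\<psi> (0 + s *\<^sub>R t)) \<le> s * b"
      using assms(2)[of "0 + s *\<^sub>R t"] by (cases "\<psi> (0 + s *\<^sub>R t)") auto
    then show "- b * s \<le> - real_of_ereal (\<psi> (0 + s *\<^sub>R t)) - - real_of_ereal (\<psi> 0)"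
      by (simp add: zero mult.commute)
  qed
  then show ?thesis
    by (simp add: real)
qed (use assms(2) in auto)

lemma support_fun_convex: "convex_fun (support_fun I)"
  unfolding convex_fun_def
proof (intro allI impI, elim conjE)
  fix u v t :: real assume t: "0 < t" "t < 1"
  show "support_fun I ((1 - t) *\<^sub>R u + t *\<^sub>R v)
      \<le> ereal (1 - t) * support_fun I u + ereal t * support_fun I v"
    unfolding support_fun_def[of I "(1 - t) *\<^sub>R u + t *\<^sub>R v"]
  proof (rule SUP_least)
    fix s assume s: "s \<in> I"
    have "ereal (s * ((1 - t) *\<^sub>R u + t *\<^sub>R v))
        = ereal (1 - t) * ereal (s * u) + ereal t * ereal (s * v)"
      by (simp add: algebra_simps)
    also have "\<dots> \<le> ereal (1 - t) * support_fun I u + ereal t * support_fun I v"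
      unfolding support_fun_def using t s
      by (intro add_mono ereal_mult_left_mono SUP_upper) auto
    finally show "ereal (s * ((1 - t) *\<^sub>R u + t *\<^sub>R v))
        \<le> ereal (1 - t) * support_fun I u + ereal t * support_fun I v" .
  qed
qed

lemma support_fun_le_liminf:
  assumes X: "X \<longlonglongrightarrow> l"
  shows "support_fun I l \<le> liminf (\<lambda>n. support_fun I (X n))"
  unfolding support_fun_def[of I l]
proof (rule SUP_least)
  fix s assume s: "s \<in> I"
  have "(\<lambda>n. ereal (s * X n)) \<longlonglongrightarrow> ereal (s * l)"
    using X by (intro tendsto_intros)
  then have "ereal (s * l) = liminf (\<lambda>n. ereal (s * X n))"
    by (intro lim_imp_Liminf[symmetric]) auto
  also have "\<dots> \<le> liminf (\<lambda>n. support_fun I (X n))"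
    unfolding support_fun_def using s by (intro Liminf_mono always_eventually allI SUP_upper)
  finally show "ereal (s * l) \<le> liminf (\<lambda>n. support_fun I (X n))" .
qed

lemma support_fun_ge_abs:
  assumes "{-\<omega>..\<omega>} \<subseteq> I" "0 \<le> \<omega>"
  shows "ereal (\<omega> * \<bar>t\<bar>) \<le> support_fun I t"
proof -
  have "\<omega> * sgn t \<in> I"
    using assms by (auto simp: sgn_real_def)
  then have "ereal ((\<omega> * sgn t) * t) \<le> support_fun I t"
    unfolding support_fun_def by (rule SUP_upper)
  then show ?thesis
    by (simp add: mult.assoc abs_sgn mult.commute[of "sgn t"])
qed

text \<open>The lower bound \<open>\<omega> \<bar>t\<bar>\<close>, which is what thresholds small coordinates, comes from the support function
of a set containing \<open>[-\<omega>, \<omega>]\<close>; the part \<open>\<psi>\<close>, stationary at the origin, only adds a nonnegative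
amount.\<close>

lemma thresholding_penalty:
  assumes \<psi>: "\<psi> \<in> Gamma0" "\<psi> 0 = 0" "has_finite_derivative \<psi> 0 0"
    and I: "{-\<omega>..\<omega>} \<subseteq> I" "0 < \<omega>"
    and G: "\<And>t. G t = \<psi> t + support_fun I t"
  shows "convex_fun G" "\<And>X l. X \<longlonglongrightarrow> l \<Longrightarrow> G l \<le> liminf (\<lambda>n. G (X n))" "G 0 = 0"
    "\<And>t. ereal (\<omega> * \<bar>t\<bar>) \<le> G t"
proof -
  have \<psi>_convex: "convex_fun \<psi>" and \<psi>_lsc: "lsc_fun \<psi>" and \<psi>_MInf: "\<And>t. \<psi> t \<noteq> - \<infinity>"
    using \<psi>(1) by (auto simp: Gamma0_def proper_fun_def)
  have \<psi>_nonneg: "0 \<le> \<psi> t" for t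
    by (rule convex_fun_stationary_nonneg[OF \<psi>_convex \<psi>_MInf \<psi>(2,3)])
  have \<sigma>_lower: "ereal (\<omega> * \<bar>t\<bar>) \<le> support_fun I t" for t
    using I by (intro support_fun_ge_abs) auto
  have \<sigma>_nonneg: "0 \<le> support_fun I t" for t
  proof -
    have "0 \<le> ereal (\<omega> * \<bar>t\<bar>)"
      using I(2) by simp
    then show ?thesis
      using \<sigma>_lower by (rule order_trans)
  qed
  show "convex_fun G"
    unfolding convex_fun_def
  proof (intro allI impI, elim conjE)
    fix u v t :: real assume t: "0 < t" "t < 1"
    have "G ((1 - t) *\<^sub>R u + t *\<^sub>R v) \<le> (ereal (1 - t) * \<psi> u + ereal t * \<psi> v)
        + (ereal (1 - t) * support_fun I u + ereal t * support_fun I v)"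
      unfolding G using t \<psi>_convex support_fun_convex[of I] unfolding convex_fun_def
      by (intro add_mono) blast+
    also have "\<dots> = ereal (1 - t) * G u + ereal t * G v"
      unfolding G using t by (simp add: ereal_right_distrib \<psi>_nonneg \<sigma>_nonneg ac_simps)
    finally show "G ((1 - t) *\<^sub>R u + t *\<^sub>R v) \<le> ereal (1 - t) * G u + ereal t * G v" .
  qed
  show "G l \<le> liminf (\<lambda>n. G (X n))" if X: "X \<longlonglongrightarrow> l" for X l
  proof -
    have "G l \<le> liminf (\<lambda>n. \<psi> (X n)) + liminf (\<lambda>n. support_fun I (X n))"
      unfolding G by (intro add_mono lsc_fun_liminf[OF \<psi>_lsc X] support_fun_le_liminf X)
    also have "\<dots> \<le> liminf (\<lambda>n. \<psi> (X n) + support_fun I (X n))"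
    proof (rule ereal_liminf_add_mono)
      have "0 \<le> liminf (\<lambda>n. \<psi> (X n))" "0 \<le> liminf (\<lambda>n. support_fun I (X n))"
        by (intro Liminf_bounded always_eventually allI \<psi>_nonneg \<sigma>_nonneg)+
      then show "\<not> (liminf (\<lambda>n. \<psi> (X n)) = \<infinity> \<and> liminf (\<lambda>n. support_fun I (X n)) = - \<infinity> \<or>
          liminf (\<lambda>n. \<psi> (X n)) = - \<infinity> \<and> liminf (\<lambda>n. support_fun I (X n)) = \<infinity>)"
        by auto
    qed
    finally show ?thesis
      by (simp add: G)
  qed
  have "I \<noteq> {}"
    using I by auto
  then show "G 0 = 0"
    by (simp add: G \<psi>(2) support_fun_def zero_ereal_def[symmetric])
  show "ereal (\<omega> * \<bar>t\<bar>) \<le> G t" for t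
    unfolding G using add_mono[OF \<psi>_nonneg[of t] \<sigma>_lower[of t]] by simp
qed

lemma convex_on_if_Gamma0:
  assumes "(\<lambda>u. ereal (h u)) \<in> Gamma0"
  shows "convex_on UNIV h"
proof (rule convex_onI)
  fix t :: real and u v assume "0 < t" "t < 1"
  then have "ereal (h ((1 - t) *\<^sub>R u + t *\<^sub>R v)) \<le> ereal (1 - t) * ereal (h u) + ereal t * ereal (h v)"
    using assms unfolding Gamma0_def convex_fun_def by blast
  then show "h ((1 - t) *\<^sub>R u + t *\<^sub>R v) \<le> (1 - t) * h u + t * h v"
    by simp
qed simp

theorem corollary4p1:
  fixes N :: "nat set"
    and e :: "nat \<Rightarrow> 'a::{real_inner, banach, second_countable_topology}"
    and h :: "'a \<Rightarrow> real" and grad_h :: "'a \<Rightarrow> 'a" and L :: real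
    and \<psi> :: "nat \<Rightarrow> real \<Rightarrow> ereal" and I :: "nat \<Rightarrow> real set"
    and g_comp :: "nat \<Rightarrow> real \<Rightarrow> ereal" and g f :: "'a \<Rightarrow> ereal"
    and x :: "nat \<Rightarrow> 'a" and \<gamma> :: real
  assumes basis: "orthonormal_basis N e"
    and h_Gamma0: "(\<lambda>u. ereal (h u)) \<in> Gamma0"
    and h_bdd_below: "bdd_below (range h)"
    and h_gradient: "\<forall>u. GDERIV h u :> grad_h u"
    and L_pos: "0 < L"
    and grad_lipschitz: "L-lipschitz_on UNIV grad_h"
    and I_interval: "\<forall>k\<in>N. is_interval (I k) \<and> closed (I k) \<and> I k \<noteq> UNIV"
    and I_omega: "\<exists>\<omega>>0. \<forall>k\<in>N. {-\<omega>..\<omega>} \<subseteq> I k"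
    and psi_Gamma0: "\<forall>k\<in>N. \<psi> k \<in> Gamma0"
    and psi_zero: "\<forall>k\<in>N. \<psi> k 0 = 0"
    and psi_deriv: "\<forall>k\<in>N. has_finite_derivative (\<psi> k) 0 0"
    and g_comp_eq: "\<forall>k\<in>N. \<forall>t. g_comp k t = \<psi> k t + support_fun (I k) t"
    and g_eq: "\<forall>u. g u = (\<Sum>\<^sub>\<infinity>k\<in>N. g_comp k (u \<bullet> e k))"
    and f_eq: "\<forall>u. f u = g u + ereal (h u)"
    and step_size: "0 < \<gamma>" "\<gamma> < 2 / L"
    and algorithm: "\<forall>n. x (Suc n) = prox \<gamma> g (x n - \<gamma> *\<^sub>R grad_h (x n))"
  shows "(\<exists>J. finite J \<and> J \<subseteq> N \<and> (\<forall>n\<ge>1. x n \<in> supp_subspace N e J)) \<and>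
         (\<exists>xbar\<in>argmin f. x \<longlonglongrightarrow> xbar)"
proof -
  obtain \<omega> where \<omega>: "0 < \<omega>" "\<And>k. k \<in> N \<Longrightarrow> {-\<omega>..\<omega>} \<subseteq> I k"
    using I_omega by blast
  have pen: "\<psi> k \<in> Gamma0" "\<psi> k 0 = 0" "has_finite_derivative (\<psi> k) 0 0" "{-\<omega>..\<omega>} \<subseteq> I k"
      "\<And>t. g_comp k t = \<psi> k t + support_fun (I k) t" if "k \<in> N" for k
    using that psi_Gamma0 psi_zero psi_deriv \<omega>(2) g_comp_eq by blast+
  note G = thresholding_penalty[OF pen(1-4) \<omega>(1) pen(5)]
  interpret separable_penalty N e g_comp \<omega> g
  proof unfold_locales
    show "convex_fun (g_comp k)" "g_comp k 0 = 0" "ereal (\<omega> * \<bar>t\<bar>) \<le> g_comp k t"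
      if "k \<in> N" for k t
      using that by (auto intro: G)
    show "g_comp k l \<le> liminf (\<lambda>n. g_comp k (X n))" if "k \<in> N" "X \<longlonglongrightarrow> l" for k X l
      using that by (intro G(2))
  qed (use basis \<omega>(1) g_eq in auto)
  interpret separable_proximal_gradient N e g_comp \<omega> g h grad_h L \<gamma>
  proof unfold_locales
    show "convex_on UNIV h"
      using h_Gamma0 by (rule convex_on_if_Gamma0)
  qed (use h_bdd_below h_gradient L_pos grad_lipschitz step_size in auto)
  have iter: "x (Suc n) = step (x n)" for n
    using algorithm by (simp add: step_def)
  obtain J where J: "finite J" "J \<subseteq> N" "\<forall>n. x (Suc n) \<in> supp_subspace N e J"
    using iterates_finite_support[where x = x, OF iter] by blast
  have "x n \<in> supp_subspace N e J" if "n \<ge> 1" for n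
    using J(3)[rule_format, of "n - 1"] that by simp
  with J(1,2) have "\<exists>J. finite J \<and> J \<subseteq> N \<and> (\<forall>n\<ge>1. x n \<in> supp_subspace N e J)"
    by blast
  moreover obtain l where l: "step l = l" "x \<longlonglongrightarrow> l"
    using iterates_converge[where x = x, OF iter] by blast
  have "f = (\<lambda>u. g u + ereal (h u))"
    using f_eq by (simp add: fun_eq_iff)
  then have "l \<in> argmin f"
    using l(1) step_fixed_iff_argmin by simp
  ultimately show ?thesis
    using l(2) by blast
qed

end
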